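(* (i) Let $S\equiv\pm\{1, 6, 7, 8, 9, 11, 12, 13, 16, 17, 19, 23\}\pmod{50}$ and $T\equiv\pm\{1, 5, 6, 7, 8, 11, 15, 17, 18, 19, 23, 24\}\pmod{50}$. Then $p(S,n)=p(T,n-1)$ for all $n\geq 1$. (ii) Let $S\equiv\pm\{1, 3, 4, 5, 7, 15, 17, 18, 19, 21, 22, 24\}\pmod{50}$ and $T\equiv\pm\{1, 2, 3, 7, 11, 14, 17, 18, 19, 21, 23, 24\}\pmod{50}$. Then $p(S,n)=p(T,n-1)$ for all $n\geq 1$. (iii) Let $S\equiv\pm\{1, 3, 4, 5, 7, 9, 12, 13, 15, 16, 21, 22\}\pmod{50}$ and $T\equiv\pm\{1, 3, 4, 6, 7, 8, 9, 13, 17, 19, 21, 22\}\pmod{50}$. Then $p(S,n)=p(T,n)$ for all integers $n\ge0$ with $n\neq 5$. (iv) Let $S\equiv\pm\{2, 3, 5, 9, 11, 12, 13, 14, 15, 16, 21, 23\}\pmod{50}$ and $T\equiv\pm\{1, 3, 7, 9, 11, 12, 13, 16, 18, 21, 23, 24\}\pmod{50}$. Then $p(S,n)=p(T,n-2)$ for all $n\geq 2$. (v) Let $S\equiv\pm\{2, 5, 6, 8, 9, 11, 13, 14, 15, 17, 19, 23\}\pmod{50}$ and $T\equiv\pm\{2, 3, 4, 9, 11, 13, 14, 17, 19, 21, 22, 23\}\pmod{50}$. Then $p(S,n)=p(T,n-2)$ for all $n\geq 2$.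
   Context: For a set $S$ of positive integers and an integer $n\ge 0$, $p(S,n)$ denotes the number of partitions of $n$ into parts belonging to $S$ (so $p(S,0)=1$). The notation $S\equiv\pm\{r_1,\dots,r_k\}\pmod M$ means that $S$ is the set of all positive integers $n$ such that $n\equiv r_i$ or $n\equiv -r_i\pmod M$ for some $i$. *)

theory Defs
  imports "HOL-Library.Multiset" "HOL-Number_Theory.Cong"
begin

definition num_partitions :: "nat set \<Rightarrow> nat \<Rightarrow> nat" where
  "num_partitions S n = card {P :: nat multiset. set_mset P \<subseteq> S \<and> sum_mset P = n}"

definition pm_residue_class :: "int set \<Rightarrow> int \<Rightarrow> nat set" where
  "pm_residue_class R M =
     {n. n > 0 \<and> (\<exists>r\<in>R. [int n = r] (mod M) \<or> [int n = - r] (mod M))}"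

text \<open>Since \<^const>\<open>card\<close> is 0 on infinite sets, \<^const>\<open>num_partitions\<close> is only meaningful
  when the set of partitions is finite, which holds for sets of positive parts.\<close>

lemma finite_partitions:
  assumes "0 \<notin> S"
  shows "finite {P :: nat multiset. set_mset P \<subseteq> S \<and> sum_mset P = n}"
proof (rule finite_subset)
  show "{P :: nat multiset. set_mset P \<subseteq> S \<and> sum_mset P = n}
      \<subseteq> mset ` {xs. set xs \<subseteq> {..n} \<and> length xs \<le> n}"
  proof
    fix P :: "nat multiset"
    assume P: "P \<in> {P. set_mset P \<subseteq> S \<and> sum_mset P = n}"
    obtain xs where xs: "P = mset xs" using ex_mset by metis
    have sum: "sum_list xs = n" using P xs by (simp add: sum_mset_sum_list)
    have "length ys \<le> sum_list ys" if "0 \<notin> set ys" for ys :: "nat list"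
      using that by (induction ys) auto
    moreover have "0 \<notin> set xs" using P xs assms by auto
    ultimately have "length xs \<le> n" using sum by blast
    moreover have "set xs \<subseteq> {..n}" using sum member_le_sum_list by fastforce
    ultimately show "P \<in> mset ` {xs. set xs \<subseteq> {..n} \<and> length xs \<le> n}" using xs by blast
  qed
  show "finite (mset ` {xs. set xs \<subseteq> {..n} \<and> length xs \<le> n})"
    by (intro finite_imageI finite_lists_length_le) simp
qed

lemma zero_notin_pm_residue_class: "0 \<notin> pm_residue_class R M"
  by (simp add: pm_residue_class_def)

end

theory Submission
  imports Defs "HOL-Analysis.Infinite_Sum" "HOL-Analysis.Infinite_Products" "HOL-Library.Nat_Bijection"
begin

text \<open>
  Let \<open>[r]\<close> be the product of \<open>1 - q ^ m\<close> over the \<open>m > 0\<close> congruent to \<open>r\<close> or \<open>- r\<close> modulo 50. The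
  generating function of the partitions with parts in \<open>S\<close> is the reciprocal of a product of such \<open>[r]\<close>,
  so each claim is a relation between products; the first one is
  \<open>[5][15][18][24] - q[9][12][13][16] = [1][5][6][7][8][9][11][12][13][15][16][17][18][19][23][24]\<close>,
  and the other four arise from it when all indices are multiplied by a power of 3.

  By the Jacobi triple product, \<open>[r]\<close> is up to simple factors a theta series, and theta series satisfy
  Weierstrass' three-term relation. These relations are homogeneous, whereas the claim has degree 4 on
  the left and degree 16 on the right. The missing inhomogeneous ingredient is the 5-dissection of
  Euler's product, a consequence of the quintuple product identity. It gives
  \<open>([10][20])\<^sup>2\<close> times the product of all other even \<open>[r]\<close> as \<open>[20]\<^sup>2 - q\<^sup>2[10][20] - q\<^sup>4[10]\<^sup>2\<close>, which turns
  the claim into a homogeneous relation that follows from the three-term relations.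
\<close>

section \<open>Sums over the integers\<close>

text \<open>Why theta values are taken in pairs: 7^2 = 49 is -1 modulo 50, so up to sign
  \<open>theta q 50 r * theta q 50 (7 * r)\<close> depends only on the orbit of r under the subgroup
  generated by 7. The units modulo 50 form a cyclic group of order 5 over this subgroup, generated
  by 3. This gives five variables from the units, five from their doubles, and two fixed ones from
  the multiples of 5. The sum of the five doubled ones, through which alone the 5-dissection enters,
  is invariant under this action, so a single polynomial identity serves all five claims. They
  differ only in the powers of q that the pairs carry, and these powers decide the shifts 1, 1, 0,
  2, 2 and the exception n = 5. The theta series are normalized by completing the square, which
  leaves fractional exponents. Therefore q is a real number in (0, 1), and partition numbers are
  recovered only at the end, by uniqueness of power series coefficients.\<close>

lemma has_sum_times:
  fixes f g :: "_ \<Rightarrow> real"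
  assumes f: "f summable_on A" and g: "g summable_on B"
  shows "((\<lambda>(x, y). f x * g y) has_sum infsum f A * infsum g B) (A \<times> B)"
proof -
  have f': "f abs_summable_on A" and g': "g abs_summable_on B"
    using f g summable_on_iff_abs_summable_on_real by blast+
  have "(\<lambda>(x, y). f x * g y) abs_summable_on A \<times> B"
  proof (rule abs_summable_on_Sigma_iff[THEN iffD2], intro conjI ballI)
    show "(\<lambda>y. case (x, y) of (x, y) \<Rightarrow> f x * g y) abs_summable_on B" for x
      using summable_on_cmult_right[OF g', of "\<bar>f x\<bar>"] by (simp add: abs_mult)
    have "(\<lambda>x. infsum (\<lambda>y. \<bar>g y\<bar>) B * \<bar>f x\<bar>) summable_on A"
      using f' by (intro summable_on_cmult_right) simp
    thus "(\<lambda>x. \<Sum>\<^sub>\<infinity>y\<in>B. norm (case (x, y) of (x, y) \<Rightarrow> f x * g y)) abs_summable_on A"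
      using g' by (simp add: abs_mult infsum_cmult_right infsum_nonneg mult.commute)
  qed
  hence s: "(\<lambda>(x, y). f x * g y) summable_on A \<times> B"
    by (rule abs_summable_summable)
  have "infsum (\<lambda>(x, y). f x * g y) (A \<times> B) = infsum (\<lambda>x. infsum (\<lambda>y. f x * g y) B) A"
    using infsum_Sigma'_banach[OF s] by simp
  also have "\<dots> = infsum f A * infsum g B"
    using f g
    by (simp add: infsum_cmult_right infsum_cmult_left)
  finally show ?thesis using has_sum_infsum[OF s] by simp
qed

lemma summable_on_geometric_int:
  assumes "0 < x" "x < (1::real)"
  shows "(\<lambda>n::int. x powr \<bar>of_int n\<bar>) summable_on UNIV"
proof -
  have g: "(\<lambda>n::nat. x powr real n) summable_on UNIV"
    using assms by (auto simp: powr_realpow intro!: norm_summable_imp_summable_on summable_geometric)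
  have "(\<lambda>n::int. x powr \<bar>of_int n\<bar>) summable_on range int"
    using g by (subst summable_on_reindex) (auto simp: o_def)
  moreover have "(\<lambda>n::int. x powr \<bar>of_int n\<bar>) summable_on range (\<lambda>k. - int k)"
    using g by (subst summable_on_reindex) (auto simp: o_def inj_on_def)
  ultimately have "(\<lambda>n::int. x powr \<bar>of_int n\<bar>) summable_on range int \<union> range (\<lambda>k. - int k)"
    by (rule summable_on_union)
  moreover have "range int \<union> range (\<lambda>k. - int k) = (UNIV :: int set)"
    by (auto intro: int_cases2)
  ultimately show ?thesis by simp
qed

lemma summable_on_powr_quadratic:
  assumes q: "0 < q" "q < (1::real)" and a: "a > 0"
  shows "(\<lambda>n::int. q powr (a * (of_int n)\<^sup>2 + b * of_int n + c)) summable_on UNIV"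
proof -
  \<comment> \<open>With this K, completing the square gives a t^2 - |b| t >= t - K for every real
    t, so the terms are dominated by a two-sided geometric series.\<close>
  define K where "K = (\<bar>b\<bar> + 1)\<^sup>2 / (4 * a)"
  have "(\<lambda>n::int. q powr (c - K) * q powr \<bar>of_int n\<bar>) summable_on UNIV"
    by (intro summable_on_cmult_right summable_on_geometric_int q)
  moreover have "norm (q powr (a * (of_int n)\<^sup>2 + b * of_int n + c)) \<le> q powr (c - K) * q powr \<bar>of_int n\<bar>" for n :: int
  proof -
    define t where "t = \<bar>real_of_int n\<bar>"
    have "0 \<le> a * (t - (\<bar>b\<bar> + 1) / (2 * a))\<^sup>2" using a by simp
    also have "\<dots> = a * t\<^sup>2 - (\<bar>b\<bar> + 1) * t + K"
      using a by (simp add: K_def power2_eq_square field_simps)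
    finally have "t - K \<le> a * t\<^sup>2 - \<bar>b\<bar> * t" by (simp add: algebra_simps)
    moreover have "- (\<bar>b\<bar> * t) \<le> b * of_int n"
      unfolding t_def abs_mult[symmetric] by linarith
    ultimately have "c - K + t \<le> a * (of_int n)\<^sup>2 + b * of_int n + c"
      by (simp add: t_def)
    hence "q powr (a * (of_int n)\<^sup>2 + b * of_int n + c) \<le> q powr (c - K + t)"
      using q by (simp add: powr_mono')
    thus ?thesis using q by (simp add: powr_add t_def)
  qed
  ultimately have "(\<lambda>n::int. q powr (a * (of_int n)\<^sup>2 + b * of_int n + c)) abs_summable_on UNIV"
    by (rule abs_summable_on_comparison_test')
  thus ?thesis by (rule abs_summable_summable)
qed

lemma infsum_int_split_mod:
  fixes f :: "int \<Rightarrow> real"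
  assumes f: "f summable_on UNIV" and p: "p > 0"
  shows "infsum f UNIV = (\<Sum>j\<in>{0..<p}. infsum (\<lambda>m. f (p * m + j)) UNIV)"
proof -
  have bij: "bij_betw (\<lambda>(j, m). p * m + j) ({0..<p} \<times> UNIV) UNIV"
    using p by (intro bij_betwI[of _ _ _ "\<lambda>n. (n mod p, n div p)"]) auto
  have s: "(\<lambda>(j, m). f (p * m + j)) summable_on ({0..<p} \<times> UNIV)"
    using summable_on_reindex_bij_betw[OF bij, of f] f by (simp add: case_prod_unfold)
  have "infsum f UNIV = infsum (\<lambda>(j, m). f (p * m + j)) ({0..<p} \<times> UNIV)"
    using infsum_reindex_bij_betw[OF bij, of f] by (simp add: case_prod_unfold)
  also have "\<dots> = infsum (\<lambda>j. infsum (\<lambda>m. f (p * m + j)) UNIV) {0..<p}"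
    using infsum_Sigma'_banach[OF s] by simp
  finally show ?thesis by simp
qed

section \<open>Theta series and the three-term relation\<close>

text \<open>For p > 0 this is the series of the Jacobi triple product with base q^p and z = q^r,
  times the power of q that completes the square in the exponent. The normalization turns the
  reflection of r and the translation by p into mere sign changes and keeps powers of q out of the
  three-term relation.\<close>

definition theta :: "real \<Rightarrow> real \<Rightarrow> real \<Rightarrow> real" where
  "theta q p r = (\<Sum>\<^sub>\<infinity>n::int. (-1) powi n * q powr ((p * of_int n + r - p / 2)\<^sup>2 / (2 * p)))"

text \<open>\<open>theta_even\<close> and \<open>theta_odd\<close> are the parts with k even and
  with k odd of the sum of \<open>q powr ((p * k + w)\<^sup>2 / (4 * p))\<close> over all integers
  k.\<close>

definition theta_even :: "real \<Rightarrow> real \<Rightarrow> real \<Rightarrow> real" where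
  "theta_even q p w = (\<Sum>\<^sub>\<infinity>n::int. q powr ((2 * p * of_int n + w)\<^sup>2 / (4 * p)))"

definition theta_odd :: "real \<Rightarrow> real \<Rightarrow> real \<Rightarrow> real" where
  "theta_odd q p w = (\<Sum>\<^sub>\<infinity>n::int. q powr ((2 * p * of_int n + p + w)\<^sup>2 / (4 * p)))"

lemma infsum_int_shift:
  fixes f :: "int \<Rightarrow> real"
  shows "infsum (\<lambda>n. f (n + k)) UNIV = infsum f UNIV"
  by (rule infsum_reindex_bij_betw) (rule bij_betwI[of _ _ _ "\<lambda>n. n - k"], auto)

lemma infsum_int_reflect:
  fixes f :: "int \<Rightarrow> real"
  shows "infsum (\<lambda>n. f (k - n)) UNIV = infsum f UNIV"
  by (rule infsum_reindex_bij_betw) (rule bij_betwI[of _ _ _ "\<lambda>n. k - n"], auto)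

lemma norm_minus_one_powi [simp]: "\<bar>(-1::real) powi n\<bar> = 1"
  by (cases "even n") auto

lemma minus_one_powi_add: "(-1::real) powi (m + n) = (-1) powi m * (-1) powi n"
  by (simp add: power_int_add)

lemma minus_one_powi_diff: "(-1::real) powi (m - n) = (-1) powi m * (-1) powi n"
  by (cases "even m"; cases "even n") auto

lemma theta_minus: "theta q p (- r) = - theta q p r"
proof -
  have "theta q p (- r) = (\<Sum>\<^sub>\<infinity>n::int. (-1) powi (1 - n) * q powr ((p * of_int (1 - n) + - r - p / 2)\<^sup>2 / (2 * p)))"
    unfolding theta_def by (rule infsum_int_reflect[symmetric])
  also have "\<dots> = (\<Sum>\<^sub>\<infinity>n::int. - ((-1) powi n * q powr ((p * of_int n + r - p / 2)\<^sup>2 / (2 * p))))"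
  proof (rule infsum_cong)
    fix n :: int
    have "(p * of_int (1 - n) + - r - p / 2)\<^sup>2 = (p * of_int n + r - p / 2)\<^sup>2"
      by (simp add: power2_eq_square field_simps)
    thus "(-1) powi (1 - n) * q powr ((p * of_int (1 - n) + - r - p / 2)\<^sup>2 / (2 * p)) =
        - ((-1) powi n * q powr ((p * of_int n + r - p / 2)\<^sup>2 / (2 * p)))"
      by (simp only: minus_one_powi_diff) simp
  qed
  finally show ?thesis unfolding theta_def by (simp only: infsum_uminus)
qed

lemma theta_add_period: "theta q p (r + p) = - theta q p r"
proof -
  have "theta q p r = (\<Sum>\<^sub>\<infinity>n::int. (-1) powi (n + 1) * q powr ((p * of_int (n + 1) + r - p / 2)\<^sup>2 / (2 * p)))"
    unfolding theta_def by (rule infsum_int_shift[symmetric])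
  also have "\<dots> = (\<Sum>\<^sub>\<infinity>n::int. - ((-1) powi n * q powr ((p * of_int n + (r + p) - p / 2)\<^sup>2 / (2 * p))))"
    by (rule infsum_cong) (simp add: minus_one_powi_add algebra_simps)
  finally show ?thesis unfolding theta_def by (simp only: infsum_uminus)
qed

lemma theta_period_minus: "theta q p (p - r) = theta q p r"
  using theta_add_period[of q p "- r"] by (simp add: theta_minus)

lemma theta_even_minus_period: "theta_even q p (w - 2 * p) = theta_even q p w"
proof -
  have "theta_even q p w = (\<Sum>\<^sub>\<infinity>n::int. q powr ((2 * p * of_int (n + (-1)) + w)\<^sup>2 / (4 * p)))"
    unfolding theta_even_def by (rule infsum_int_shift[symmetric])
  thus ?thesis unfolding theta_even_def by (simp add: algebra_simps)
qed

lemma theta_odd_conv_even: "theta_odd q p w = theta_even q p (w + p)"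
  unfolding theta_even_def theta_odd_def by (simp add: algebra_simps)

lemma summable_on_theta:
  fixes q p c :: real
  assumes "0 < q" "q < 1" "p > 0"
  shows "(\<lambda>n::int. q powr ((p * of_int n + c)\<^sup>2 / (2 * p))) summable_on UNIV"
proof -
  have "(\<lambda>n::int. q powr (p / 2 * (of_int n)\<^sup>2 + c * of_int n + c\<^sup>2 / (2 * p))) summable_on UNIV"
    using assms by (intro summable_on_powr_quadratic) auto
  also have "(\<lambda>n::int. p / 2 * (of_int n)\<^sup>2 + c * of_int n + c\<^sup>2 / (2 * p)) =
      (\<lambda>n. (p * of_int n + c)\<^sup>2 / (2 * p))"
    using assms by (auto simp: power2_eq_square field_simps)
  finally show ?thesis .
qed

lemma summable_on_minus_one_powi:
  fixes q :: real
  assumes "(\<lambda>n. q powr f n) summable_on A"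
  shows "(\<lambda>n. (-1) powi g n * q powr f n) summable_on A"
proof -
  have "(\<lambda>n. norm ((-1) powi g n * q powr f n)) summable_on A"
    using assms by (simp add: abs_mult)
  thus ?thesis by (rule abs_summable_summable)
qed

text \<open>The sum over all pairs \<open>(m, n)\<close> splits according to the parity of \<open>m + n\<close>; in the
  coordinates \<open>m + n\<close>, \<open>m - n\<close> both parts factor.\<close>

lemma theta_mult:
  assumes q: "0 < q" "q < 1" and p: "p > 0"
  shows "theta q p ((u + v) / 2) * theta q p ((u - v) / 2) =
    theta_odd q p u * theta_even q p v - theta_even q p u * theta_odd q p v"
proof -
  define x where "x = (u + v) / 2 - p / 2"
  define y where "y = (u - v) / 2 - p / 2"
  define F where "F = (\<lambda>(m::int, n::int). (-1) powi m * q powr ((p * of_int m + x)\<^sup>2 / (2 * p)) *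
    ((-1) powi n * q powr ((p * of_int n + y)\<^sup>2 / (2 * p))))"
  have F_eq: "F (m, n) = (-1) powi (m + n) * q powr (((p * of_int m + x)\<^sup>2 + (p * of_int n + y)\<^sup>2) / (2 * p))" for m n
    by (simp add: F_def minus_one_powi_add powr_add add_divide_distrib)
  define e where "e = (\<lambda>c (n::int). q powr ((2 * p * of_int n + c)\<^sup>2 / (4 * p)))"
  have e: "e c summable_on UNIV" for c
    using summable_on_theta[of q "2 * p" c] q p by (simp add: e_def)
  have F: "(F has_sum theta q p ((u + v) / 2) * theta q p ((u - v) / 2)) (UNIV \<times> UNIV)"
    unfolding theta_def F_def x_def y_def
    using has_sum_times[OF summable_on_minus_one_powi[OF summable_on_theta[of q p "(u + v) / 2 - p / 2"], of "\<lambda>n. n"]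
      summable_on_minus_one_powi[OF summable_on_theta[of q p "(u - v) / 2 - p / 2"], of "\<lambda>n. n"]] q p
    by (simp add: algebra_simps)
  define G where "G = (\<lambda>(k::int, l::int). (k + l, k - l))"
  define H where "H = (\<lambda>(k::int, l::int). (k + l + 1, k - l))"
  have inj: "inj G" "inj H" by (auto simp: G_def H_def inj_on_def)
  have "range G \<union> range H = UNIV"
  proof -
    have "(m, n) \<in> range G \<union> range H" for m n
    proof (cases "even (m + n)")
      case True
      hence "m = (m + n) div 2 + (m - n) div 2" "n = (m + n) div 2 - (m - n) div 2"
        by presburger+
      hence "(m, n) = G ((m + n) div 2, (m - n) div 2)" by (simp add: G_def)
      thus ?thesis by blast
    next
      case False
      hence "m = (m + n - 1) div 2 + (m - n - 1) div 2 + 1" "n = (m + n - 1) div 2 - (m - n - 1) div 2"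
        by presburger+
      hence "(m, n) = H ((m + n - 1) div 2, (m - n - 1) div 2)" by (simp add: H_def)
      thus ?thesis by blast
    qed
    thus ?thesis by auto
  qed
  moreover have "range G \<inter> range H = {}"
    by (auto simp: G_def H_def) presburger
  moreover have "(F has_sum theta_even q p (u - p) * theta_even q p v) (range G)"
  proof (subst has_sum_reindex[OF inj(1)])
    have "(F \<circ> G) = (\<lambda>(k, l). e (u - p) k * e v l)"
    proof (rule ext, clarify)
      fix k l :: int
      have "((p * of_int (k + l) + x)\<^sup>2 + (p * of_int (k - l) + y)\<^sup>2) / (2 * p) =
        (2 * p * of_int k + (u - p))\<^sup>2 / (4 * p) + (2 * p * of_int l + v)\<^sup>2 / (4 * p)"
        using p by (simp add: x_def y_def power2_eq_square field_simps)
      hence "(F \<circ> G) (k, l) = (-1) powi (2 * k) * (e (u - p) k * e v l)"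
        by (simp only: G_def o_def F_eq prod.case powr_add e_def) simp
      thus "(F \<circ> G) (k, l) = e (u - p) k * e v l" by simp
    qed
    thus "(F \<circ> G has_sum theta_even q p (u - p) * theta_even q p v) UNIV"
      using has_sum_times[OF e[of "u - p"] e[of v]] by (simp add: theta_even_def e_def)
  qed
  moreover have "(F has_sum - (theta_odd q p (u - p) * theta_odd q p v)) (range H)"
  proof (subst has_sum_reindex[OF inj(2)])
    have "(F \<circ> H) = (\<lambda>z. - (case z of (k, l) \<Rightarrow> e u k * e (p + v) l))"
    proof
      fix z :: "int \<times> int"
      obtain k l where z: "z = (k, l)" by force
      have "((p * of_int (k + l + 1) + x)\<^sup>2 + (p * of_int (k - l) + y)\<^sup>2) / (2 * p) =
        (2 * p * of_int k + u)\<^sup>2 / (4 * p) + (2 * p * of_int l + (p + v))\<^sup>2 / (4 * p)"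
        using p by (simp add: x_def y_def power2_eq_square field_simps)
      hence "(F \<circ> H) (k, l) = (-1) powi (2 * k + 1) * (e u k * e (p + v) l)"
        by (simp only: H_def o_def F_eq prod.case powr_add e_def) simp
      thus "(F \<circ> H) z = - (case z of (k, l) \<Rightarrow> e u k * e (p + v) l)" by (simp add: z)
    qed
    thus "(F \<circ> H has_sum - (theta_odd q p (u - p) * theta_odd q p v)) UNIV"
      using has_sum_times[OF e[of u] e[of "p + v"]]
      by (simp add: has_sum_uminus theta_odd_def e_def add.assoc)
  qed
  ultimately have "(F has_sum theta_even q p (u - p) * theta_even q p v
      + - (theta_odd q p (u - p) * theta_odd q p v)) UNIV"
    by (metis has_sum_Un_disjoint)
  hence "theta q p ((u + v) / 2) * theta q p ((u - v) / 2) =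
      theta_even q p (u - p) * theta_even q p v - theta_odd q p (u - p) * theta_odd q p v"
    using F has_sum_unique by (fastforce simp: UNIV_Times_UNIV)
  \<comment> \<open>The two offsets p/2 of the theta series add up, so both parts come out at
    \<open>u - p\<close>. By the period 2p this is the same as \<open>u + p\<close>, which exchanges
    even and odd.\<close>
  moreover have "theta_even q p (u - p) = theta_odd q p u"
    using theta_even_minus_period[of q p "u + p"] by (simp add: theta_odd_conv_even)
  ultimately show ?thesis by (simp add: theta_odd_conv_even)
qed

text \<open>By \<open>theta_mult\<close> each product of two theta values is a 2 x 2 minor of the
  matrix with columns \<open>(theta_odd q p x, theta_even q p x)\<close> for x = i, j, k, l. The
  claim is the Pluecker relation between the six minors of a 2 x 4 matrix.\<close>

theorem theta_three_term:
  assumes "0 < q" "q < 1" "p > 0"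
  shows "theta q p ((i + j) / 2) * theta q p ((i - j) / 2) * (theta q p ((k + l) / 2) * theta q p ((k - l) / 2))
    - theta q p ((i + k) / 2) * theta q p ((i - k) / 2) * (theta q p ((j + l) / 2) * theta q p ((j - l) / 2))
    + theta q p ((i + l) / 2) * theta q p ((i - l) / 2) * (theta q p ((j + k) / 2) * theta q p ((j - k) / 2)) = 0"
  unfolding theta_mult[OF assms] by algebra

section \<open>Jacobi triple product\<close>

definition qfact :: "real \<Rightarrow> nat \<Rightarrow> real" where
  "qfact q n = (\<Prod>i<n. 1 - q ^ Suc i)"

text \<open>Gaussian binomial coefficients, given by the q-Pascal rule instead of a quotient of
  \<open>qfact\<close> values; this avoids division, and \<open>qbinomial_theorem\<close> holds for
  every q.\<close>

fun qbinomial :: "real \<Rightarrow> nat \<Rightarrow> nat \<Rightarrow> real" where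
  "qbinomial q n 0 = 1"
| "qbinomial q 0 (Suc k) = 0"
| "qbinomial q (Suc n) (Suc k) = qbinomial q n (Suc k) + q ^ (n - k) * qbinomial q n k"

lemma qfact_0 [simp]: "qfact q 0 = 1"
  and qfact_Suc: "qfact q (Suc n) = qfact q n * (1 - q ^ Suc n)"
  by (simp_all add: qfact_def)

lemma qbinomial_eq_0: "n < k \<Longrightarrow> qbinomial q n k = 0"
  by (induction q n k rule: qbinomial.induct) auto

lemma qbinomial_theorem:
  "(\<Prod>i<n. 1 + x * q ^ i) = (\<Sum>k\<le>n. qbinomial q n k * q ^ (k choose 2) * x ^ k)"
proof (induction n)
  case (Suc n)
  have "(\<Sum>k\<le>Suc n. qbinomial q (Suc n) k * q ^ (k choose 2) * x ^ k) =
      1 + (\<Sum>k\<le>n. qbinomial q (Suc n) (Suc k) * q ^ (Suc k choose 2) * x ^ Suc k)"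
    by (subst sum.atMost_Suc_shift) (simp add: numeral_2_eq_2)
  also have "(\<Sum>k\<le>n. qbinomial q (Suc n) (Suc k) * q ^ (Suc k choose 2) * x ^ Suc k) =
      (\<Sum>k\<le>n. qbinomial q n (Suc k) * q ^ (Suc k choose 2) * x ^ Suc k) +
      (\<Sum>k\<le>n. x * q ^ n * (qbinomial q n k * q ^ (k choose 2) * x ^ k))"
    unfolding sum.distrib[symmetric]
  proof (rule sum.cong)
    fix k assume "k \<in> {..n}"
    hence eq: "q ^ (n - k) * q ^ (Suc k choose 2) = q ^ n * q ^ (k choose 2)"
      by (simp add: power_add[symmetric] numeral_2_eq_2)
    have "(u + v * w) * y * (x * t) = u * y * (x * t) + x * c * (w * d * t)"
      if "v * y = c * d" for u v w y t c d :: real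
      using that by algebra
    from this[OF eq]
    show "qbinomial q (Suc n) (Suc k) * q ^ (Suc k choose 2) * x ^ Suc k =
      qbinomial q n (Suc k) * q ^ (Suc k choose 2) * x ^ Suc k +
      x * q ^ n * (qbinomial q n k * q ^ (k choose 2) * x ^ k)"
      by simp
  qed simp
  also have "1 + ((\<Sum>k\<le>n. qbinomial q n (Suc k) * q ^ (Suc k choose 2) * x ^ Suc k) +
      (\<Sum>k\<le>n. x * q ^ n * (qbinomial q n k * q ^ (k choose 2) * x ^ k))) =
      (\<Sum>k\<le>Suc n. qbinomial q n k * q ^ (k choose 2) * x ^ k) +
      x * q ^ n * (\<Sum>k\<le>n. qbinomial q n k * q ^ (k choose 2) * x ^ k)"
  proof -
    have "qbinomial q n 0 * q ^ (0 choose 2) * x ^ 0 = 1" by (simp add: choose_two)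
    hence "(\<Sum>k\<le>Suc n. qbinomial q n k * q ^ (k choose 2) * x ^ k) =
        1 + (\<Sum>k\<le>n. qbinomial q n (Suc k) * q ^ (Suc k choose 2) * x ^ Suc k)"
      using sum.atMost_Suc_shift[of "\<lambda>k. qbinomial q n k * q ^ (k choose 2) * x ^ k" n] by argo
    thus ?thesis by (simp only: sum_distrib_left add.assoc)
  qed
  also have "\<dots> = (\<Prod>i<Suc n. 1 + x * q ^ i)"
    using Suc by (simp add: qbinomial_eq_0 algebra_simps)
  finally show ?case by simp
qed (simp add: choose_two)

lemma qbinomial_qfact:
  "k \<le> n \<Longrightarrow> qbinomial q n k * qfact q k * qfact q (n - k) = qfact q n"
proof (induction n arbitrary: k)
  case (Suc n)
  show ?case
  proof (cases k)
    case k: (Suc j)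
    hence "j \<le> n" using Suc.prems by simp
    have 1: "qbinomial q n j * qfact q j * qfact q (n - j) = qfact q n"
      using Suc.IH \<open>j \<le> n\<close> by blast
    have 2: "qbinomial q n k * qfact q k * qfact q (n - j) = (1 - q ^ (n - j)) * qfact q n"
    proof (cases "j = n")
      case False
      hence "n - j = Suc (n - k)" and "k \<le> n" using k \<open>j \<le> n\<close> by auto
      thus ?thesis using Suc.IH[of k] by (simp add: qfact_Suc)
    qed (simp add: k qbinomial_eq_0)
    have 3: "q ^ (n - j) * q ^ Suc j = q ^ Suc n"
      using \<open>j \<le> n\<close> by (simp add: power_add[symmetric])
    have "qbinomial q (Suc n) k * qfact q k * qfact q (Suc n - k) =
        qbinomial q n k * qfact q k * qfact q (n - j) +
        q ^ (n - j) * (1 - q ^ Suc j) * (qbinomial q n j * qfact q j * qfact q (n - j))"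
      by (simp add: k qfact_Suc algebra_simps)
    also have "\<dots> = qfact q (Suc n)"
      unfolding 1 2 qfact_Suc 3[symmetric] by algebra
    finally show ?thesis .
  qed simp
qed simp

lemma qfact_pos: "0 < q \<Longrightarrow> q < 1 \<Longrightarrow> qfact q n > 0"
  unfolding qfact_def by (intro prod_pos) (auto simp: power_less_one_iff simp del: power_Suc)

lemma qfact_le_1: "0 < q \<Longrightarrow> q < 1 \<Longrightarrow> qfact q n \<le> 1"
  unfolding qfact_def by (intro prod_le_1) (auto simp: power_le_one simp del: power_Suc)

lemma convergent_prod_one_minus_powers:
  fixes q :: real
  assumes "0 < q" "q < 1" and f: "\<And>i. f i \<noteq> 0 \<Longrightarrow> f i = q ^ i"
  shows "convergent_prod (\<lambda>i. 1 - f i)"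
proof -
  have "summable (\<lambda>i. norm (f i))"
  proof (rule summable_comparison_test[OF exI[of _ 0]])
    show "\<forall>n\<ge>0. norm (norm (f n)) \<le> q ^ n"
    proof (intro allI impI)
      show "norm (norm (f n)) \<le> q ^ n" for n
        using f[of n] assms(1,2) by (cases "f n = 0") simp_all
    qed
    show "summable ((^) q)" using assms by (intro summable_geometric) auto
  qed
  hence "abs_convergent_prod (\<lambda>i. 1 - f i)"
    by (intro summable_imp_abs_convergent_prod) simp
  thus ?thesis by (rule abs_convergent_prod_imp_convergent_prod)
qed

lemma qfact_LIMSEQ:
  assumes q: "0 < q" "q < 1"
  obtains L where "qfact q \<longlonglongrightarrow> L" "L > 0" "\<And>n. L \<le> qfact q n"
proof -
  have "convergent_prod (\<lambda>i. 1 - (if i = 0 then 0 else q ^ i))"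
    using q by (intro convergent_prod_one_minus_powers) (auto split: if_splits)
  hence "convergent_prod (\<lambda>i. 1 - (if Suc i = 0 then 0 else q ^ Suc i))"
    by (subst convergent_prod_Suc_iff[where f = "\<lambda>i. 1 - (if i = 0 then 0 else q ^ i)"])
  hence c: "convergent_prod (\<lambda>i. 1 - q ^ Suc i)" by simp
  define L where "L = (\<Prod>i. 1 - q ^ Suc i)"
  have "(\<lambda>n. qfact q (Suc n)) \<longlonglongrightarrow> L"
    using convergent_prod_LIMSEQ[OF c] by (simp add: qfact_def L_def lessThan_Suc_atMost)
  hence lim: "qfact q \<longlonglongrightarrow> L" by (rule LIMSEQ_imp_Suc)
  have nz: "L \<noteq> 0"
    unfolding L_def using q c by (intro prodinf_nonzero) (simp_all add: power_less_one_iff less_imp_neq del: power_Suc)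
  have dec: "decseq (qfact q)"
  proof (rule decseq_SucI)
    show "qfact q (Suc n) \<le> qfact q n" for n
      unfolding qfact_Suc using q qfact_pos[OF q, of n] by (simp add: mult_le_cancel_left1 del: power_Suc)
  qed
  have le: "L \<le> qfact q n" for n using decseq_ge[OF dec lim] .
  have "L \<ge> 0" using lim by (rule LIMSEQ_le_const) (auto intro!: less_imp_le qfact_pos q)
  with nz have "L > 0" by simp
  with lim le show ?thesis by (intro that)
qed

text \<open>This is the q-binomial theorem for 2N factors at x = -z/q^N. Dividing by q^N centres the
  product: the last N factors are the 1 - z q^i, and the first N, read backwards, are the 1 -
  q^(i+1)/z up to the monomials collected in \<open>c\<close>. The index k = N + n of the binomial
  sum is centred accordingly.\<close>

lemma finite_jacobi_triple_product:
  fixes q z :: real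
  assumes q: "0 < q" and z: "0 < z"
  shows "(\<Prod>i<N. (1 - z * q ^ i) * (1 - q ^ Suc i / z)) =
    (\<Sum>n\<in>{-int N..int N}. (-1) powi n * (q powr (of_int n * (of_int n - 1) / 2) * z powr of_int n) *
      qbinomial q (2 * N) (nat (int N + n)))"
proof -
  define c where "c = (\<Prod>i<N. - (z / q ^ Suc i))"
  have c: "c = (-1) ^ N * (z powr N / q powr (N * (N + 1) / 2))"
    unfolding c_def
  proof (induction N)
    case (Suc N)
    have "q powr (real (Suc N) * (real (Suc N) + 1) / 2) = q powr (real N * (real N + 1) / 2) * q powr real (Suc N)"
      by (simp add: powr_add[symmetric] field_simps)
    also have "q powr real (Suc N) = q ^ Suc N" using q by (intro powr_realpow) auto
    finally show ?case using Suc z by (simp add: powr_add powr_realpow field_simps)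
  qed (use z q in simp)
  have c0: "c \<noteq> 0" using q z by (simp add: c_def)
  have "(\<Sum>k\<le>2 * N. qbinomial q (2 * N) k * q ^ (k choose 2) * (- (z / q ^ N)) ^ k) =
      (\<Prod>i<2 * N. 1 + - (z / q ^ N) * q ^ i)"
    by (rule qbinomial_theorem[symmetric])
  also have "\<dots> = (\<Prod>i<N. 1 - z / q ^ N * q ^ i) * (\<Prod>i<N. 1 - z / q ^ N * q ^ (i + N))"
  proof -
    have "(\<Prod>i<N + N. f i) = (\<Prod>i<N. f i) * (\<Prod>i<N. f (i + N))" for f :: "nat \<Rightarrow> real"
      by (simp add: lessThan_atLeast0 prod.atLeastLessThan_concat[of 0 N "N + N", symmetric]
          prod.atLeastLessThan_shift_0[of _ N "N + N"] add.commute)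
    thus ?thesis by (simp add: mult_2)
  qed
  also have "(\<Prod>i<N. 1 - z / q ^ N * q ^ (i + N)) = (\<Prod>i<N. 1 - z * q ^ i)"
    using q by (simp add: power_add)
  also have "(\<Prod>i<N. 1 - z / q ^ N * q ^ i) = (\<Prod>i<N. 1 - z / q ^ N * q ^ (N - Suc i))"
    by (rule prod.nat_diff_reindex[symmetric])
  also have "\<dots> = (\<Prod>i<N. - (z / q ^ Suc i) * (1 - q ^ Suc i / z))"
  proof (rule prod.cong)
    fix i assume "i \<in> {..<N}"
    hence "q ^ N = q ^ (N - Suc i) * q ^ Suc i" by (simp add: power_add[symmetric] del: power_Suc)
    thus "1 - z / q ^ N * q ^ (N - Suc i) = - (z / q ^ Suc i) * (1 - q ^ Suc i / z)"
      using q z by (simp add: field_simps del: power_Suc)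
  qed simp
  also have "\<dots> = c * (\<Prod>i<N. 1 - q ^ Suc i / z)"
    by (simp only: prod.distrib c_def)
  finally have "(\<Prod>i<N. (1 - z * q ^ i) * (1 - q ^ Suc i / z)) =
      (\<Sum>k\<le>2 * N. qbinomial q (2 * N) k * q ^ (k choose 2) * (- (z / q ^ N)) ^ k / c)"
    using c0 by (simp add: prod.distrib sum_divide_distrib[symmetric])
  also have "\<dots> = (\<Sum>n\<in>{-int N..int N}. (-1) powi n * (q powr (of_int n * (of_int n - 1) / 2) * z powr of_int n) *
      qbinomial q (2 * N) (nat (int N + n)))"
  proof (rule sum.reindex_bij_witness[of _ "\<lambda>n. nat (int N + n)" "\<lambda>k. int k - int N"])
    fix k assume "k \<in> {..2 * N}"
    have "real (k choose 2) = real k * (real k - 1) / 2"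
      by (induction k) (auto simp: numeral_2_eq_2 field_simps)
    moreover have "q ^ (k choose 2) = q powr real (k choose 2)"
      using q by (simp add: powr_realpow)
    ultimately have "q ^ (k choose 2) = q powr (real k * (real k - 1) / 2)" by (simp only:)
    moreover have "(- (z / q ^ N)) ^ k = (-1) ^ k * (z powr k / q powr (N * k))"
      using q z by (simp add: powr_realpow power_mult power_divide power_minus[of "z / q ^ N"] flip: of_nat_mult)
    moreover have "(-1) ^ k / (-1) ^ N = ((-1) powi (int k - int N) :: real)"
      by (simp add: power_int_diff)
    moreover have "q powr (real k * (real k - 1) / 2) / q powr (N * k) * q powr (N * (N + 1) / 2) =
        q powr (of_int (int k - int N) * (of_int (int k - int N) - 1) / 2)"
    proof -
      have "real k * (real k - 1) / 2 - N * k + N * (N + 1) / 2 =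
          of_int (int k - int N) * (of_int (int k - int N) - 1) / 2"
        by (simp add: field_simps)
      thus ?thesis by (simp only: powr_diff[symmetric] powr_add[symmetric])
    qed
    moreover have "z powr k / z powr N = z powr of_int (int k - int N)"
      by (simp add: powr_diff)
    ultimately show "(-1) powi (int k - int N) * (q powr (of_int (int k - int N) * (of_int (int k - int N) - 1) / 2)
        * z powr of_int (int k - int N)) * qbinomial q (2 * N) (nat (int N + (int k - int N))) =
        qbinomial q (2 * N) k * q ^ (k choose 2) * (- (z / q ^ N)) ^ k / c"
      unfolding c
    proof -
      assume 1: "q ^ (k choose 2) = q powr (real k * (real k - 1) / 2)"
        and 2: "(- (z / q ^ N)) ^ k = (-1) ^ k * (z powr k / q powr (N * k))"
        and 3: "(-1) ^ k / (-1) ^ N = ((-1) powi (int k - int N) :: real)"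
        and 4: "q powr (real k * (real k - 1) / 2) / q powr (N * k) * q powr (N * (N + 1) / 2) =
          q powr (of_int (int k - int N) * (of_int (int k - int N) - 1) / 2)"
        and 5: "z powr k / z powr N = z powr of_int (int k - int N)"
      show "(-1) powi (int k - int N) * (q powr (of_int (int k - int N) * (of_int (int k - int N) - 1) / 2)
          * z powr of_int (int k - int N)) * qbinomial q (2 * N) (nat (int N + (int k - int N))) =
          qbinomial q (2 * N) k * q ^ (k choose 2) * (- (z / q ^ N)) ^ k /
          ((-1) ^ N * (z powr N / q powr (N * (N + 1) / 2)))"
        unfolding 1 2 3[symmetric] 4[symmetric] 5[symmetric] by (simp add: mult_ac)
    qed
  qed auto
  finally show ?thesis .
qed

text \<open>In the finite form, the coefficient \<open>B N n\<close> tends to 1/L for fixed n, where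
  L is the limit of \<open>qfact q\<close>, and it is bounded by 1/L^2 because \<open>qfact\<close>
  lies between L and 1. Dominated convergence gives the series times 1/L; the extra factors
  \<open>1 - q ^ Suc i\<close> multiply this by L.\<close>

theorem jacobi_triple_product_LIMSEQ:
  fixes q z :: real
  assumes q: "0 < q" "q < 1" and z: "0 < z"
  shows "(\<lambda>N. \<Prod>i<N. (1 - z * q ^ i) * (1 - q ^ Suc i / z) * (1 - q ^ Suc i)) \<longlonglongrightarrow>
    (\<Sum>\<^sub>\<infinity>n::int. (-1) powi n * (q powr (of_int n * (of_int n - 1) / 2) * z powr of_int n))"
proof -
  obtain L where L: "qfact q \<longlonglongrightarrow> L" "L > 0" "\<And>n. L \<le> qfact q n"
    using qfact_LIMSEQ[OF q] by blast
  define w where "w n = q powr (of_int n * (of_int n - 1) / 2) * z powr of_int n" for n :: int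
  define B where "B N n = (if n \<in> {-int N..int N} then qbinomial q (2 * N) (nat (int N + n)) else 0)" for N n
  have w: "w summable_on UNIV"
  proof -
    have "(\<lambda>n::int. q powr (1 / 2 * (of_int n)\<^sup>2 + (log q z - 1 / 2) * of_int n + 0)) summable_on UNIV"
      using q by (intro summable_on_powr_quadratic) auto
    moreover have "q powr (1 / 2 * (of_int n)\<^sup>2 + (log q z - 1 / 2) * of_int n + 0) = w n" for n :: int
    proof -
      have "z powr of_int n = q powr (log q z * of_int n)"
        using q z by (simp add: powr_powr[symmetric] powr_log_cancel)
      thus ?thesis
        by (simp add: w_def powr_add[symmetric] power2_eq_square field_simps)
    qed
    ultimately show ?thesis by simp
  qed
  have w_pos: "w n > 0" for n using q z by (simp add: w_def)
  have B_eq: "B N n = qfact q (2 * N) / (qfact q (nat (int N + n)) * qfact q (nat (int N - n)))"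
    if "n \<in> {-int N..int N}" for N n
  proof -
    have "2 * N - nat (int N + n) = nat (int N - n)" using that by auto
    moreover have "nat (int N + n) \<le> 2 * N" using that by auto
    ultimately have "B N n * qfact q (nat (int N + n)) * qfact q (nat (int N - n)) = qfact q (2 * N)"
      using qbinomial_qfact[of "nat (int N + n)" "2 * N" q] that by (simp add: B_def)
    thus ?thesis
      using qfact_pos[OF q, THEN less_imp_neq, THEN not_sym] by (simp add: divide_simps mult.assoc)
  qed
  have B_le: "\<bar>B N n\<bar> \<le> 1 / L\<^sup>2" for N n
  proof (cases "n \<in> {-int N..int N}")
    case True
    have "qfact q (2 * N) / (qfact q (nat (int N + n)) * qfact q (nat (int N - n))) \<le> 1 / (L * L)"
      using L(2,3) qfact_le_1[OF q] qfact_pos[OF q] by (intro frac_le mult_mono) (auto intro: less_imp_le)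
    moreover have "B N n \<ge> 0"
      unfolding B_eq[OF True] using qfact_pos[OF q] by (simp add: less_imp_le)
    ultimately show ?thesis by (simp add: B_eq[OF True] power2_eq_square)
  qed (auto simp: B_def)
  have B_lim: "(\<lambda>N. B N n) \<longlonglongrightarrow> 1 / L" for n
  proof -
    have ev: "\<forall>\<^sub>F N in sequentially. n \<in> {-int N..int N}"
      using eventually_ge_at_top[of "nat \<bar>n\<bar>"] by eventually_elim auto
    have "filterlim (\<lambda>N. nat (int N + k)) sequentially sequentially" for k
      unfolding filterlim_at_top
    proof
      fix Z show "\<forall>\<^sub>F N in sequentially. Z \<le> nat (int N + k)"
        using eventually_ge_at_top[of "Z + nat \<bar>k\<bar>"] by eventually_elim auto
    qed
    note lim = filterlim_compose[OF L(1) this]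
    have "(\<lambda>N. qfact q (2 * N)) \<longlonglongrightarrow> L"
      by (rule filterlim_compose[OF L(1)]) (simp add: filterlim_subseq strict_mono_def)
    hence "(\<lambda>N. qfact q (2 * N) / (qfact q (nat (int N + n)) * qfact q (nat (int N - n)))) \<longlonglongrightarrow> L / (L * L)"
      using lim[of n] lim[of "- n"] L(2) by (intro tendsto_divide tendsto_mult) auto
    hence "(\<lambda>N. qfact q (2 * N) / (qfact q (nat (int N + n)) * qfact q (nat (int N - n)))) \<longlonglongrightarrow> 1 / L"
      using L(2) by simp
    moreover have "\<forall>\<^sub>F N in sequentially.
        qfact q (2 * N) / (qfact q (nat (int N + n)) * qfact q (nat (int N - n))) = B N n"
      using ev by eventually_elim (simp only: B_eq)
    ultimately show ?thesis by (rule Lim_transform_eventually)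
  qed
  \<comment> \<open>Tannery's theorem is about series indexed by natural numbers, so the integers
    are enumerated by \<open>int_decode\<close>.\<close>
  define a where "a k N = (-1) powi (int_decode k) * w (int_decode k) * B N (int_decode k)" for k N
  define b where "b k = (-1) powi (int_decode k) * w (int_decode k) * (1 / L)" for k
  have w': "(\<lambda>k. w (int_decode k)) summable_on UNIV"
    using w summable_on_reindex_bij_betw[OF bij_int_decode, of w] by simp
  hence sw: "summable (\<lambda>k. w (int_decode k) * (1 / L\<^sup>2))"
    by (intro summable_mult2 summable_on_imp_summable)
  have "(\<lambda>N. suminf (\<lambda>k. a k N)) \<longlonglongrightarrow> suminf b"
  proof (rule tannerys_theorem[THEN conjunct2, THEN conjunct2])
    show "(\<lambda>N. a k N) \<longlonglongrightarrow> b k" for k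
      unfolding a_def b_def by (intro tendsto_mult tendsto_const B_lim)
    show "\<forall>\<^sub>F (k, N) in at_top \<times>\<^sub>F sequentially. norm (a k N) \<le> w (int_decode k) * (1 / L\<^sup>2)"
    proof (rule always_eventually, clarify)
      show "norm (a k N) \<le> w (int_decode k) * (1 / L\<^sup>2)" for k N
        using w_pos[of "int_decode k"] B_le[of N "int_decode k"]
        by (simp add: a_def abs_mult mult_left_mono del: times_divide_eq_right)
    qed
  qed (use sw in auto)
  moreover have "suminf (\<lambda>k. a k N) = (\<Prod>i<N. (1 - z * q ^ i) * (1 - q ^ Suc i / z))" for N
  proof -
    have "((\<lambda>n. (-1) powi n * w n * B N n) has_sum
        (\<Sum>n\<in>{-int N..int N}. (-1) powi n * w n * B N n)) UNIV"
      by (rule has_sum_finite_neutralI[of "{-int N..int N}"]) (auto simp: B_def)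
    hence "((\<lambda>k. a k N) has_sum (\<Sum>n\<in>{-int N..int N}. (-1) powi n * w n * B N n)) UNIV"
      using has_sum_reindex_bij_betw[OF bij_int_decode, of "\<lambda>n. (-1) powi n * w n * B N n"]
      by (simp add: a_def)
    hence "suminf (\<lambda>k. a k N) = (\<Sum>n\<in>{-int N..int N}. (-1) powi n * w n * B N n)"
      by (intro sums_unique[symmetric] has_sum_imp_sums)
    also have "\<dots> = (\<Prod>i<N. (1 - z * q ^ i) * (1 - q ^ Suc i / z))"
      unfolding finite_jacobi_triple_product[OF q(1) z] by (rule sum.cong) (auto simp: B_def w_def)
    finally show ?thesis .
  qed
  moreover have "suminf b = (\<Sum>\<^sub>\<infinity>n. (-1) powi n * w n) * (1 / L)"
  proof -
    have "(\<lambda>n. (-1) powi n * w n) summable_on UNIV"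
      by (rule abs_summable_summable) (use w w_pos in \<open>simp add: abs_mult less_imp_le\<close>)
    hence "((\<lambda>n. (-1) powi n * w n) has_sum (\<Sum>\<^sub>\<infinity>n. (-1) powi n * w n)) UNIV"
      by (rule has_sum_infsum)
    hence "((\<lambda>k. (-1) powi (int_decode k) * w (int_decode k)) has_sum (\<Sum>\<^sub>\<infinity>n. (-1) powi n * w n)) UNIV"
      using has_sum_reindex_bij_betw[OF bij_int_decode, of "\<lambda>n. (-1) powi n * w n"] by simp
    hence "b sums ((\<Sum>\<^sub>\<infinity>n. (-1) powi n * w n) * (1 / L))"
      unfolding b_def by (intro sums_mult2 has_sum_imp_sums)
    thus ?thesis by (rule sums_unique[symmetric])
  qed
  ultimately have "(\<lambda>N. \<Prod>i<N. (1 - z * q ^ i) * (1 - q ^ Suc i / z)) \<longlonglongrightarrow>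
      (\<Sum>\<^sub>\<infinity>n. (-1) powi n * w n) * (1 / L)"
    by simp
  from tendsto_mult[OF this L(1)] L(2) show ?thesis
    by (simp add: w_def qfact_def prod.distrib[symmetric])
qed

section \<open>Infinite products over sets of exponents and their identification with theta
  series\<close>

definition qprod :: "real \<Rightarrow> nat set \<Rightarrow> real" where
  "qprod q S = (\<Prod>m. if m \<in> S then 1 - q ^ m else 1)"

lemma convergent_qprod:
  fixes q :: real
  assumes "0 < q" "q < 1" "0 \<notin> S"
  shows "convergent_prod (\<lambda>m. if m \<in> S then 1 - q ^ m else 1)"
proof -
  have "convergent_prod (\<lambda>m. 1 - (if m \<in> S then q ^ m else 0))"
    using assms by (intro convergent_prod_one_minus_powers) (auto split: if_splits)
  also have "(\<lambda>m. 1 - (if m \<in> S then q ^ m else 0)) = (\<lambda>m. if m \<in> S then 1 - q ^ m else 1)"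
    by auto
  finally show ?thesis .
qed

lemma qprod_LIMSEQ:
  fixes q :: real
  assumes "0 < q" "q < 1" "0 \<notin> S"
  shows "(\<lambda>N. \<Prod>m<N. if m \<in> S then 1 - q ^ m else 1) \<longlonglongrightarrow> qprod q S"
proof -
  have "(\<lambda>N. \<Prod>m<Suc N. if m \<in> S then 1 - q ^ m else 1) \<longlonglongrightarrow> qprod q S"
    using convergent_prod_LIMSEQ[OF convergent_qprod[OF assms]]
    by (simp only: qprod_def lessThan_Suc_atMost)
  thus ?thesis by (rule LIMSEQ_imp_Suc)
qed

lemma qprod_nonzero:
  fixes q :: real
  assumes "0 < q" "q < 1" "0 \<notin> S"
  shows "qprod q S \<noteq> 0"
proof -
  have "1 - q ^ m \<noteq> 0" if "m \<in> S" for m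
    using that assms by (cases m) (auto simp: power_less_one_iff less_imp_neq simp del: power_Suc)
  thus ?thesis unfolding qprod_def by (intro prodinf_nonzero convergent_qprod assms) auto
qed

lemma qprod_Un:
  fixes q :: real
  assumes "0 < q" "q < 1" "0 \<notin> S" "0 \<notin> T" "S \<inter> T = {}"
  shows "qprod q (S \<union> T) = qprod q S * qprod q T"
  unfolding qprod_def
  by (subst prodinf_mult) (use assms in \<open>auto intro!: convergent_qprod prodinf_cong\<close>)

text \<open>Among any M consecutive exponents exactly three are selected, as
  \<open>2 * r \<noteq> M\<close> keeps r and M - r apart. They form one factor of the triple
  product with base q^M and z = q^r. The power of q in front is the one that completes the
  square.\<close>

theorem qprod_eq_theta:
  fixes M r :: nat
  assumes q: "0 < q" "q < 1" and r: "0 < r" "r < M" "2 * r \<noteq> M"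
  shows "q powr ((real r - real M / 2)\<^sup>2 / (2 * real M)) * qprod q {m. m > 0 \<and> m mod M \<in> {0, r, M - r}} = theta q (real M) (real r)"
proof -
  define S where "S = {m. m > 0 \<and> m mod M \<in> {0, r, M - r}}"
  define Q where "Q = q ^ M"
  define z where "z = q ^ r"
  have Q: "0 < Q" "Q < 1" and z: "0 < z" using q r by (auto simp: Q_def z_def power_less_one_iff)
  have block: "(\<Prod>m\<in>{M * N<..M * N + M}. if m \<in> S then 1 - q ^ m else 1) =
      (1 - z * Q ^ N) * (1 - Q ^ Suc N / z) * (1 - Q ^ Suc N)" for N
  proof -
    have "m \<in> S \<longleftrightarrow> m \<in> {M * N + r, M * N + (M - r), M * N + M}" if "m \<in> {M * N<..M * N + M}" for m
    proof -
      define i where "i = m - M * N"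
      have m: "m = M * N + i" and i: "0 < i" "i \<le> M" using that by (auto simp: i_def)
      have "m mod M = (if i = M then 0 else i)" using i by (simp add: m)
      thus ?thesis using i r by (auto simp: S_def m)
    qed
    hence "(\<Prod>m\<in>{M * N<..M * N + M}. if m \<in> S then 1 - q ^ m else 1) =
        (\<Prod>m\<in>{M * N<..M * N + M}. if m \<in> {M * N + r, M * N + (M - r), M * N + M} then 1 - q ^ m else 1)"
      by (intro prod.cong) auto
    also have "\<dots> = (\<Prod>m\<in>{M * N + r, M * N + (M - r), M * N + M}. 1 - q ^ m)"
      using r by (subst prod.inter_restrict[symmetric]) (auto intro!: prod.cong)
    also have "\<dots> = (1 - q ^ (M * N + r)) * (1 - q ^ (M * N + (M - r))) * (1 - q ^ (M * N + M))"
      using r by (auto simp: mult.assoc)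
    also have "q ^ (M * N + r) = z * Q ^ N" by (simp add: power_add power_mult z_def Q_def)
    also have "q ^ (M * N + M) = Q ^ Suc N" by (simp add: power_add power_mult Q_def)
    also have "q ^ (M * N + (M - r)) = Q ^ Suc N / z"
      using q r by (simp add: power_add power_mult power_diff Q_def z_def)
    finally show ?thesis .
  qed
  have "(\<Prod>i<N. (1 - z * Q ^ i) * (1 - Q ^ Suc i / z) * (1 - Q ^ Suc i)) =
      (\<Prod>m<Suc (M * N). if m \<in> S then 1 - q ^ m else 1)" for N
  proof (induction N)
    case 0
    have "0 \<notin> S" by (simp add: S_def)
    thus ?case by simp
  next
    case (Suc N)
    have "{..<Suc (K + M)} = {..<Suc K} \<union> {K<..K + M}" for K by auto
    hence "(\<Prod>m<Suc (K + M). f m) = (\<Prod>m<Suc K. f m) * (\<Prod>m\<in>{K<..K + M}. f m)"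
      for K and f :: "nat \<Rightarrow> real"
      by (simp only:) (rule prod.union_disjoint, auto)
    from this[of _ "M * N"] show ?case
      unfolding prod.lessThan_Suc[of _ N] Suc
      by (simp only: block mult_Suc_right add.commute[of M])
  qed
  hence "(\<lambda>N. \<Prod>m<Suc (M * N). if m \<in> S then 1 - q ^ m else 1) \<longlonglongrightarrow>
    (\<Sum>\<^sub>\<infinity>n::int. (-1) powi n * (Q powr (of_int n * (of_int n - 1) / 2) * z powr of_int n))"
    using jacobi_triple_product_LIMSEQ[OF Q z] by simp
  moreover have "(\<lambda>N. \<Prod>m<Suc (M * N). if m \<in> S then 1 - q ^ m else 1) \<longlonglongrightarrow> qprod q S"
  proof (rule filterlim_compose[OF qprod_LIMSEQ[OF q]])
    show "0 \<notin> S" by (simp add: S_def)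
    have "strict_mono (\<lambda>N. Suc (M * N))" using r by (intro strict_monoI) simp
    thus "filterlim (\<lambda>N. Suc (M * N)) sequentially sequentially" by (rule filterlim_subseq)
  qed
  ultimately have "qprod q S = (\<Sum>\<^sub>\<infinity>n::int. (-1) powi n * (Q powr (of_int n * (of_int n - 1) / 2) * z powr of_int n))"
    by (rule LIMSEQ_unique[rotated])
  hence "q powr ((real r - real M / 2)\<^sup>2 / (2 * real M)) * qprod q S =
    (\<Sum>\<^sub>\<infinity>n::int. q powr ((real r - real M / 2)\<^sup>2 / (2 * real M)) * ((-1) powi n * (Q powr (of_int n * (of_int n - 1) / 2) * z powr of_int n)))"
    by (simp only: infsum_cmult_right')
  also have "\<dots> = theta q (real M) (real r)"
    unfolding theta_def
  proof (rule infsum_cong)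
    fix n :: int
    have "(real r - real M / 2)\<^sup>2 / (2 * real M) + real M * (of_int n * (of_int n - 1) / 2) + real r * of_int n =
        (real M * of_int n + real r - real M / 2)\<^sup>2 / (2 * real M)"
      using r by (simp add: power2_eq_square field_simps)
    moreover have "Q powr (of_int n * (of_int n - 1) / 2) = q powr (real M * (of_int n * (of_int n - 1) / 2))"
      using q by (simp only: Q_def powr_powr[symmetric] powr_realpow)
    moreover have "z powr of_int n = q powr (real r * of_int n)"
      using q by (simp only: z_def powr_powr[symmetric] powr_realpow)
    ultimately have "q powr ((real r - real M / 2)\<^sup>2 / (2 * real M)) *
        (Q powr (of_int n * (of_int n - 1) / 2) * z powr of_int n) =
        q powr ((real M * of_int n + real r - real M / 2)\<^sup>2 / (2 * real M))"
      by (simp only: powr_add[symmetric] add.assoc[symmetric])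
    thus "q powr ((real r - real M / 2)\<^sup>2 / (2 * real M)) * ((-1) powi n * (Q powr (of_int n * (of_int n - 1) / 2) * z powr of_int n)) =
      (-1) powi n * q powr ((real M * of_int n + real r - real M / 2)\<^sup>2 / (2 * real M))"
      by (simp only: mult.left_commute)
  qed
  finally show ?thesis unfolding S_def .
qed

section \<open>Quintuple product and 5-dissection\<close>

lemma infsum_int_pair_parity:
  fixes f :: "int \<times> int \<Rightarrow> real"
  assumes "f summable_on UNIV"
  shows "infsum f UNIV = infsum (\<lambda>(m, n). f (2 * m, n)) UNIV + infsum (\<lambda>(m, n). f (2 * m + 1, n)) UNIV"
proof -
  define G where "G = (\<lambda>(m::int, n::int). (2 * m, n))"
  define H where "H = (\<lambda>(m::int, n::int). (2 * m + 1, n))"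
  have inj: "inj G" "inj H" by (auto simp: G_def H_def inj_on_def)
  have un: "range G \<union> range H = UNIV"
  proof -
    have "(k, n) \<in> range G \<union> range H" for k n
    proof (cases "even k")
      case True
      hence "(k, n) = G (k div 2, n)" by (simp add: G_def)
      thus ?thesis by blast
    next
      case False
      hence "(k, n) = H (k div 2, n)" by (simp add: H_def)
      thus ?thesis by blast
    qed
    thus ?thesis by auto
  qed
  have "range G \<inter> range H = {}" by (auto simp: G_def H_def) presburger
  hence "infsum f (range G \<union> range H) = infsum f (range G) + infsum f (range H)"
    using assms by (intro infsum_Un_disjoint) (auto intro: summable_on_subset_banach)
  thus ?thesis
    unfolding un infsum_reindex[OF inj(1)] infsum_reindex[OF inj(2)]
    by (simp add: o_def G_def H_def case_prod_unfold)
qed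

text \<open>Collect the terms of the double series on the left by the exponent of \<open>q\<^sup>r\<close>: those with odd exponent
  cancel, and those with even exponent form the two parity classes of the double series on the right.\<close>

theorem quintuple_product:
  assumes q: "0 < q" "q < 1" and p: "p > 0"
  shows "(theta q (3 * p) (2 * p - 3 * r) + theta q (3 * p) (2 * p + 3 * r)) * theta q p r =
    theta q p (2 * r) * theta q (3 * p) p"
proof -
  define th where "th = (\<lambda>p r (n::int). (-1) powi n * q powr ((p * of_int n + r - p / 2)\<^sup>2 / (2 * p)))"
  have th: "th p r summable_on UNIV" if "p > 0" for p r
    unfolding th_def using that q
    by (simp only: add_diff_eq[symmetric]) (intro summable_on_minus_one_powi summable_on_theta, auto)
  have theta: "theta q p r = infsum (th p r) UNIV" for p r by (simp add: theta_def th_def)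
  define e where "e = (\<lambda>(p::real) r (n::int). (p * of_int n + r - p / 2)\<^sup>2 / (2 * p))"
  have th2: "th p r m * th p' r' n = (-1) powi (m + n) * q powr (e p r m + e p' r' n)" for p r m p' r' n
    by (simp add: th_def e_def minus_one_powi_add powr_add)
  \<comment> \<open>Up to a factor common to all three series, N is the exponent of q^r in the terms
    of \<open>G1\<close> and \<open>G2\<close>, and \<open>2 * M\<close> is the exponent in those of
    \<open>K\<close>.\<close>
  define G1 where "G1 = (\<lambda>(N, n). th (3 * p) (2 * p - 3 * r) n * th p r (N + 3 * n))"
  define G2 where "G2 = (\<lambda>(N, n). th (3 * p) (2 * p + 3 * r) n * th p r (N - 3 * n - 1))"
  define K where "K = (\<lambda>(m, M). th p (2 * r) M * th (3 * p) p (m + M))"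
  have "bij_betw (\<lambda>(N::int, n::int). (n, N + 3 * n)) UNIV (UNIV \<times> UNIV)"
    by (rule bij_betwI[of _ _ _ "\<lambda>(n, k). (k - 3 * n, n)"]) auto
  from has_sum_reindex_bij_betw[OF this, of "\<lambda>(n, k). th (3 * p) (2 * p - 3 * r) n * th p r k"]
  have G1: "(G1 has_sum theta q (3 * p) (2 * p - 3 * r) * theta q p r) UNIV"
    using has_sum_times[OF th th, of "3 * p" p] p by (simp add: G1_def theta case_prod_unfold)
  have "bij_betw (\<lambda>(N::int, n::int). (n, N - 3 * n - 1)) UNIV (UNIV \<times> UNIV)"
    by (rule bij_betwI[of _ _ _ "\<lambda>(n, k). (k + 3 * n + 1, n)"]) auto
  from has_sum_reindex_bij_betw[OF this, of "\<lambda>(n, k). th (3 * p) (2 * p + 3 * r) n * th p r k"]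
  have G2: "(G2 has_sum theta q (3 * p) (2 * p + 3 * r) * theta q p r) UNIV"
    using has_sum_times[OF th th, of "3 * p" p] p by (simp add: G2_def theta case_prod_unfold)
  have "bij_betw (\<lambda>(m::int, M::int). (M, m + M)) UNIV (UNIV \<times> UNIV)"
    by (rule bij_betwI[of _ _ _ "\<lambda>(M, l). (l - M, M)"]) auto
  from has_sum_reindex_bij_betw[OF this, of "\<lambda>(M, l). th p (2 * r) M * th (3 * p) p l"]
  have K: "(K has_sum theta q p (2 * r) * theta q (3 * p) p) UNIV"
    using has_sum_times[OF th th, of p "3 * p"] p by (simp add: K_def theta case_prod_unfold)
  have "infsum (\<lambda>(M, n). G1 (2 * M + 1, n)) UNIV = infsum (\<lambda>(M, n). - G2 (2 * M + 1, n + M)) UNIV"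
  proof (rule infsum_cong, clarify)
    fix M n :: int
    have "e (3 * p) (2 * p - 3 * r) n + e p r (2 * M + 1 + 3 * n) =
        e (3 * p) (2 * p + 3 * r) (n + M) + e p r (2 * M + 1 - 3 * (n + M) - 1)"
      using p by (simp add: e_def power2_eq_square field_simps)
    moreover have "(-1 :: real) powi (n + (2 * M + 1 + 3 * n)) =
        - ((-1) powi (n + M + (2 * M + 1 - 3 * (n + M) - 1)))"
      by auto
    ultimately show "G1 (2 * M + 1, n) = - G2 (2 * M + 1, n + M)"
      by (simp only: G1_def G2_def th2 prod.case)
  qed
  also have "\<dots> = infsum (\<lambda>(M, n). - G2 (2 * M + 1, n)) UNIV"
  proof -
    have "bij_betw (\<lambda>(M::int, n::int). (M, n + M)) UNIV UNIV"
      by (rule bij_betwI[of _ _ _ "\<lambda>(M, n). (M, n - M)"]) auto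
    from infsum_reindex_bij_betw[OF this, of "\<lambda>(M, n). - G2 (2 * M + 1, n)"]
    show ?thesis by (simp add: case_prod_unfold)
  qed
  finally have odd: "infsum (\<lambda>(M, n). G1 (2 * M + 1, n)) UNIV + infsum (\<lambda>(M, n). G2 (2 * M + 1, n)) UNIV = 0"
    by (simp add: case_prod_unfold infsum_uminus)
  have "infsum (\<lambda>(n, M). K (2 * n, M)) UNIV = infsum (\<lambda>(M, n). G1 (2 * M, n)) UNIV"
  proof -
    have "bij_betw (\<lambda>(n::int, M::int). (M, n)) UNIV UNIV"
      by (rule bij_betwI[of _ _ _ "\<lambda>(M, n). (n, M)"]) auto
    from infsum_reindex_bij_betw[OF this, of "\<lambda>(M, n). G1 (2 * M, n)"]
    have "infsum (\<lambda>(M, n). G1 (2 * M, n)) UNIV = infsum (\<lambda>(n, M). G1 (2 * M, n)) UNIV"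
      by (simp add: case_prod_unfold)
    also have "\<dots> = infsum (\<lambda>(n, M). K (2 * n, M)) UNIV"
    proof (rule infsum_cong, clarify)
      fix n M :: int
      have "e (3 * p) (2 * p - 3 * r) n + e p r (2 * M + 3 * n) = e p (2 * r) M + e (3 * p) p (2 * n + M)"
        using p by (simp add: e_def power2_eq_square field_simps)
      thus "G1 (2 * M, n) = K (2 * n, M)"
        by (auto simp: G1_def K_def th2)
    qed
    finally show ?thesis ..
  qed
  moreover have "infsum (\<lambda>(n, M). K (2 * n + 1, M)) UNIV = infsum (\<lambda>(M, n). G2 (2 * M, n)) UNIV"
  proof -
    have "bij_betw (\<lambda>(n::int, M::int). (M, n + M)) UNIV UNIV"
      by (rule bij_betwI[of _ _ _ "\<lambda>(M, n). (n - M, M)"]) auto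
    from infsum_reindex_bij_betw[OF this, of "\<lambda>(M, n). G2 (2 * M, n)"]
    have "infsum (\<lambda>(M, n). G2 (2 * M, n)) UNIV = infsum (\<lambda>(n, M). G2 (2 * M, n + M)) UNIV"
      by (simp add: case_prod_unfold)
    also have "\<dots> = infsum (\<lambda>(n, M). K (2 * n + 1, M)) UNIV"
    proof (rule infsum_cong, clarify)
      fix n M :: int
      have "e (3 * p) (2 * p + 3 * r) (n + M) + e p r (2 * M - 3 * (n + M) - 1) =
          e p (2 * r) M + e (3 * p) p (2 * n + 1 + M)"
        using p by (simp add: e_def power2_eq_square field_simps)
      thus "G2 (2 * M, n + M) = K (2 * n + 1, M)"
        by (auto simp: G2_def K_def th2)
    qed
    finally show ?thesis ..
  qed
  moreover have "G1 summable_on UNIV" "G2 summable_on UNIV" "K summable_on UNIV"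
    using G1 G2 K by (auto simp: summable_on_def)
  note this[THEN infsum_int_pair_parity]
  ultimately have "infsum K UNIV = infsum G1 UNIV + infsum G2 UNIV"
    using odd by linarith
  thus ?thesis using G1 G2 K by (simp add: infsumI distrib_right)
qed

text \<open>\<open>theta q 6 2\<close> is Euler's pentagonal series in q^2. Splitting n modulo 5
  gives five series of level 150: the class of 1 is \<open>theta q 150 50\<close> up to sign, and
  the other four form two pairs. With p = 50 and r = 10, 20 the quintuple product evaluates the
  pairs as \<open>theta q 150 50\<close> times the quotient of \<open>theta q 50 20\<close> by
  \<open>theta q 50 10\<close> and times its inverse.\<close>

lemma theta_dissection_5:
  assumes q: "0 < q" "q < 1"
  shows "theta q 6 2 * (theta q 50 10 * theta q 50 20) =
    theta q 150 50 * ((theta q 50 20)\<^sup>2 - theta q 50 10 * theta q 50 20 - (theta q 50 10)\<^sup>2)"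
proof -
  define f where "f = (\<lambda>n::int. (-1) powi n * q powr ((6 * of_int n + 2 - 6 / 2)\<^sup>2 / (2 * 6)))"
  have f: "f summable_on UNIV"
    unfolding f_def using q
    by (simp only: add_diff_eq[symmetric]) (intro summable_on_minus_one_powi summable_on_theta, auto)
  have "infsum (\<lambda>m. f (5 * m + j)) UNIV = (-1) powi j * theta q 150 (70 + 30 * of_int j)" for j
  proof -
    have "f (5 * m + j) = (-1) powi j * ((-1) powi m * q powr ((150 * of_int m + (70 + 30 * of_int j) - 150 / 2)\<^sup>2 / (2 * 150)))" for m
    proof -
      have "(6 * of_int (5 * m + j) + 2 - 6 / 2)\<^sup>2 / (2 * 6) =
          (150 * of_int m + (70 + 30 * of_int j) - 150 / 2)\<^sup>2 / (2 * 150 :: real)"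
        by (simp add: power2_eq_square field_simps)
      moreover have "(-1 :: real) powi (5 * m + j) = (-1) powi j * (-1) powi m"
        by (cases "even m"; cases "even j") auto
      ultimately show ?thesis unfolding f_def by (simp only: mult.assoc)
    qed
    thus ?thesis by (simp only: theta_def infsum_cmult_right')
  qed
  moreover have "theta q 6 2 = (\<Sum>j\<in>{0..<5}. infsum (\<lambda>m. f (5 * m + j)) UNIV)"
    unfolding theta_def using infsum_int_split_mod[OF f, of 5] by (simp only: f_def)
  moreover have "{0..<5::int} = {0, 1, 2, 3, 4}" by auto
  ultimately have "theta q 6 2 = theta q 150 70 - theta q 150 100 + theta q 150 130
      - theta q 150 160 + theta q 150 190"
    by simp
  moreover have "theta q 150 100 = theta q 150 50" using theta_period_minus[of q 150 50] by simp
  moreover have "theta q 150 190 = - theta q 150 40" using theta_add_period[of q 150 40] by simp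
  ultimately have 1: "theta q 6 2 = (theta q 150 70 + theta q 150 130) - theta q 150 50
      - (theta q 150 40 + theta q 150 160)"
    by simp
  have 2: "(theta q 150 70 + theta q 150 130) * theta q 50 10 = theta q 50 20 * theta q 150 50"
    using quintuple_product[OF q, of 50 10] by simp
  have "theta q 50 40 = theta q 50 10" using theta_period_minus[of q 50 10] by simp
  hence 3: "(theta q 150 40 + theta q 150 160) * theta q 50 20 = theta q 50 10 * theta q 150 50"
    using quintuple_product[OF q, of 50 20] by simp
  show ?thesis unfolding 1 using 2 3 by algebra
qed

section \<open>Relations between theta values of level 50\<close>

text \<open>With \<open>t r = theta q 50 r\<close>, the variables stand for \<open>a\<^sub>k = \<plusminus> t r * t (7 * r)\<close> where
  \<open>r = 3 ^ k\<close>, for \<open>b\<^sub>k = \<plusminus> t r * t (7 * r)\<close> where \<open>r = 2 * 3 ^ k\<close>, and for \<open>f = t 5 * t 15\<close>,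
  \<open>g = t 10 * t 20\<close>. Multiplication of all indices by 3 rotates the \<open>a\<^sub>k\<close> and the \<open>b\<^sub>k\<close>.\<close>

definition theta_quadrics ::
  "real \<Rightarrow> real \<Rightarrow> real \<Rightarrow> real \<Rightarrow> real \<Rightarrow> real \<Rightarrow> real \<Rightarrow> real \<Rightarrow> real \<Rightarrow> real \<Rightarrow> real \<Rightarrow> real \<Rightarrow> bool"
where
  "theta_quadrics a0 a1 a2 a3 a4 b0 b1 b2 b3 b4 f g \<longleftrightarrow>
    a0 * a2 = a3 * a4 + b2 * g \<and> a1 * a3 = a4 * a0 + b3 * g \<and> a2 * a4 = a0 * a1 + b4 * g \<and>
    a3 * a0 = a1 * a2 + b0 * g \<and> a4 * a1 = a2 * a3 + b1 * g \<and>
    a0 * f = a3 * a4 - b2 * b4 \<and> a1 * f = a4 * a0 - b3 * b0 \<and> a2 * f = a0 * a1 - b4 * b1 \<and>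
    a3 * f = a1 * a2 - b0 * b2 \<and> a4 * f = a2 * a3 - b1 * b3 \<and>
    b0 * b1 = b2 * (b4 + g) \<and> b1 * b2 = b3 * (b0 + g) \<and> b2 * b3 = b4 * (b1 + g) \<and>
    b3 * b4 = b0 * (b2 + g) \<and> b4 * b0 = b1 * (b3 + g)"

lemma theta_quadrics_rotate:
  "theta_quadrics a0 a1 a2 a3 a4 b0 b1 b2 b3 b4 f g \<Longrightarrow> theta_quadrics a1 a2 a3 a4 a0 b1 b2 b3 b4 b0 f g"
  unfolding theta_quadrics_def by blast

text \<open>The products \<open>b\<^sub>i * b\<^sub>j\<close> with \<open>i \<noteq> j\<close>, the products \<open>b\<^sub>i * g\<close>, and \<open>g\<^sup>2\<close> are polynomials in the
  \<open>a\<^sub>k\<close> and \<open>f\<close>. In these variables the claim, multiplied by \<open>b\<^sub>3\<close>, is a combination of the relations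
  \<open>(b\<^sub>i * b\<^sub>j) * (b\<^sub>k * g) = (b\<^sub>i * b\<^sub>k) * (b\<^sub>j * g)\<close> and \<open>g\<^sup>2 * (b\<^sub>i * b\<^sub>j) = (b\<^sub>i * g) * (b\<^sub>j * g)\<close>; the
  coefficients were found by linear algebra.\<close>

lemma theta_quadrics_identity:
  assumes rel: "theta_quadrics a0 a1 a2 a3 a4 b0 b1 b2 b3 b4 f g"
    and nz: "g \<noteq> 0" "b0 \<noteq> 0" "b1 \<noteq> 0" "b3 \<noteq> 0"
  shows "b0 * b3 * (f * b2 - a2 * b4) * g\<^sup>2 + a0 * a2 * a3 * a4 * f * (b0 + b1 + b2 + b3 + b4) = 0" (is "?T = 0")
proof -
  define G where "G = g\<^sup>2"
  have bg: "a0 * a2 - a3 * a4 = b2 * g"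
    "a1 * a3 - a4 * a0 = b3 * g"
    "a2 * a4 - a0 * a1 = b4 * g"
    "a3 * a0 - a1 * a2 = b0 * g"
    "a4 * a1 - a2 * a3 = b1 * g"
    and bb2: "a3 * a4 - a0 * f = b2 * b4"
    "a4 * a0 - a1 * f = b3 * b0"
    "a0 * a1 - a2 * f = b4 * b1"
    "a1 * a2 - a3 * f = b0 * b2"
    "a2 * a3 - a4 * f = b1 * b3"
    using rel unfolding theta_quadrics_def by argo+
  \<comment> \<open>Comparing the relations for \<open>a0 * a2\<close> and \<open>a0 * f\<close>
    gives \<open>a0 * (a2 - f) = b2 * (b4 + g)\<close>, which is \<open>b0 * b1\<close> by the third
    group of relations; the other four are rotations of this.\<close>
  have bb1: "a0 * (a2 - f) = b0 * b1"
    "a1 * (a3 - f) = b1 * b2"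
    "a2 * (a4 - f) = b2 * b3"
    "a3 * (a0 - f) = b3 * b4"
    "a4 * (a1 - f) = b4 * b0"
    using rel unfolding theta_quadrics_def by (simp_all add: algebra_simps)
  \<comment> \<open>After multiplication by \<open>b0 * g\<close> this is a combination of the five
    relations between the b's and g alone. Together with \<open>bb1\<close> it makes g^2 a
    polynomial in the a's and f.\<close>
  have "b0 * b1 + b1 * b2 + b2 * b3 + b3 * b4 + b4 * b0 + g\<^sup>2 = 0"
  proof -
    have "b0 * g * (b0 * b1 + b1 * b2 + b2 * b3 + b3 * b4 + b4 * b0 + g\<^sup>2) =
        (b0 * b4 - b0 * g) * (b2 * (b4 + g) - b0 * b1) + (b0 * b2 + b4 * g) * (b3 * (b0 + g) - b1 * b2)
        + b0\<^sup>2 * (b4 * (b1 + g) - b2 * b3) + (b1 * b2 + g\<^sup>2) * (b0 * (b2 + g) - b3 * b4)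
        + b2 * b4 * (b1 * (b3 + g) - b4 * b0)"
      by (simp add: algebra_simps power2_eq_square)
    also have "\<dots> = 0" using rel unfolding theta_quadrics_def by simp
    finally show ?thesis using nz by simp
  qed
  hence G: "G = f * (a0 + a1 + a2 + a3 + a4) - (a0 * a2 + a1 * a3 + a2 * a4 + a3 * a0 + a4 * a1)"
    using bb1 unfolding G_def by (simp add: algebra_simps)
  \<comment> \<open>The sum of the b's multiplied by b3 contains the square of b3, which the
    relations do not give directly. It is reached through
    \<open>(b0 * b3) * (b1 * b3) = (b0 * b1) * b3\<^sup>2\<close>, and the factor f is available
    because it accompanies the sum in the claim.\<close>
  have b3_sq: "f * b3\<^sup>2 = f * a1\<^sup>2 - a0 * f\<^sup>2 + a0 * G"
  proof -
    have "f * ((a4 * a0 - a1 * f) * (a2 * a3 - a4 * f)) - (a0 * (a2 - f)) * (f * a1\<^sup>2 - a0 * f\<^sup>2 + a0 * G) =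
      - a0 * (G * (a0 * (a2 - f)) - (a3 * a0 - a1 * a2) * (a4 * a1 - a2 * a3))
      + f * ((a4 * a0 - a1 * f) * (a2 * a4 - a0 * a1) - (a4 * (a1 - f)) * (a1 * a3 - a4 * a0))
      - a3 * ((a0 * (a2 - f)) * (a2 * a4 - a0 * a1) - (a0 * a1 - a2 * f) * (a3 * a0 - a1 * a2))
      + a0 * ((a1 * a2 - a3 * f) * (a4 * a1 - a2 * a3) - (a1 * (a3 - f)) * (a3 * a0 - a1 * a2))
      - f * ((a4 * a0 - a1 * f) * (a4 * a1 - a2 * a3) - (a2 * a3 - a4 * f) * (a3 * a0 - a1 * a2))
      + a0 * ((a2 * a3 - a4 * f) * (a2 * a4 - a0 * a1) - (a3 * (a0 - f)) * (a4 * a1 - a2 * a3))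
      - f * ((a0 * (a2 - f)) * (a3 * a4 - a0 * f) - (a4 * (a1 - f)) * (a1 * (a3 - f)))"
      unfolding G by (simp add: algebra_simps power2_eq_square)
    also have "\<dots> = 0" unfolding bg bb1 bb2 G_def by (simp add: power2_eq_square)
    finally have "b0 * b1 * (f * b3\<^sup>2 - (f * a1\<^sup>2 - a0 * f\<^sup>2 + a0 * G)) = 0"
      unfolding bb1 bb2 by (simp add: algebra_simps power2_eq_square)
    thus ?thesis using nz by simp
  qed
  have "b3 * ?T = b3 * b0 * (f * (b2 * b3) - a2 * (b3 * b4)) * G
      + a0 * a2 * a3 * a4 * (f * b3\<^sup>2 + f * (b3 * b0 + b1 * b3 + b2 * b3 + b3 * b4))"
    unfolding G_def by (simp add: algebra_simps power2_eq_square)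
  also have "\<dots> = (a4 * a0 - a1 * f) * (f * (a2 * (a4 - f)) - a2 * (a3 * (a0 - f))) * G + a0 * a2 * a3 * a4 * ((f * a1\<^sup>2 - a0 * f\<^sup>2 + a0 * G) + f * ((a4 * a0 - a1 * f) + (a2 * a3 - a4 * f) + (a2 * (a4 - f)) + (a3 * (a0 - f))))"
    unfolding b3_sq bb1 bb2 by (simp add: mult_ac)
  also have "\<dots> = a2 * f * ((a4 - f) * (G * (a4 * a0 - a1 * f) - (a3 * a0 - a1 * a2) * (a1 * a3 - a4 * a0)) + a1 * (G * (a3 * (a0 - f)) - (a1 * a3 - a4 * a0) * (a2 * a4 - a0 * a1))
        + a3 * ((a0 * (a2 - f)) * (a1 * a3 - a4 * a0) - (a4 * a0 - a1 * f) * (a4 * a1 - a2 * a3)) - a1 * ((a0 * a1 - a2 * f) * (a1 * a3 - a4 * a0) - (a3 * (a0 - f)) * (a4 * a1 - a2 * a3)))"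
    unfolding G by (simp add: algebra_simps power2_eq_square)
  also have "\<dots> = 0" unfolding bg bb1 bb2 G_def by (simp add: power2_eq_square)
  finally show ?thesis using nz by simp
qed

lemma theta_50_reduce:
  "theta q 50 26 = theta q 50 24"
  "theta q 50 27 = theta q 50 23"
  "theta q 50 28 = theta q 50 22"
  "theta q 50 29 = theta q 50 21"
  "theta q 50 30 = theta q 50 20"
  "theta q 50 31 = theta q 50 19"
  "theta q 50 32 = theta q 50 18"
  "theta q 50 33 = theta q 50 17"
  "theta q 50 34 = theta q 50 16"
  "theta q 50 35 = theta q 50 15"
  "theta q 50 36 = theta q 50 14"
  "theta q 50 37 = theta q 50 13"
  "theta q 50 38 = theta q 50 12"
  "theta q 50 39 = theta q 50 11"
  "theta q 50 40 = theta q 50 10"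
  "theta q 50 41 = theta q 50 9"
  "theta q 50 42 = theta q 50 8"
  "theta q 50 43 = theta q 50 7"
  "theta q 50 44 = theta q 50 6"
  "theta q 50 45 = theta q 50 5"
  "theta q 50 46 = theta q 50 4"
  "theta q 50 47 = theta q 50 3"
  "theta q 50 48 = theta q 50 2"
  "theta q 50 49 = theta q 50 1"
  using theta_period_minus[of q 50 1] theta_period_minus[of q 50 2] theta_period_minus[of q 50 3]
    theta_period_minus[of q 50 4] theta_period_minus[of q 50 5] theta_period_minus[of q 50 6]
    theta_period_minus[of q 50 7] theta_period_minus[of q 50 8] theta_period_minus[of q 50 9]
    theta_period_minus[of q 50 10] theta_period_minus[of q 50 11] theta_period_minus[of q 50 12]
    theta_period_minus[of q 50 13] theta_period_minus[of q 50 14] theta_period_minus[of q 50 15]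
    theta_period_minus[of q 50 16] theta_period_minus[of q 50 17] theta_period_minus[of q 50 18]
    theta_period_minus[of q 50 19] theta_period_minus[of q 50 20] theta_period_minus[of q 50 21]
    theta_period_minus[of q 50 22] theta_period_minus[of q 50 23] theta_period_minus[of q 50 24]
  by simp_all

context
  fixes q :: real and t :: "real \<Rightarrow> real"
  assumes q: "0 < q" "q < 1"
  defines "t \<equiv> theta q 50"
begin

lemma theta_quadrics_theta_50:
  "theta_quadrics (t 1 * t 7) (t 3 * t 21) (- (t 9 * t 13)) (- (t 11 * t 23)) (t 17 * t 19)
    (t 2 * t 14) (- (t 6 * t 8)) (t 18 * t 24) (- (t 4 * t 22)) (- (t 12 * t 16)) (t 5 * t 15) (t 10 * t 20)"
proof -
  \<comment> \<open>The parameters are twice the usual ones: 48, 34, 14, 12 have half-sums and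
    half-differences 41, 7, 13, 1 and so on, and \<open>theta_50_reduce\<close> reflects 41 to 9.
    The first three relations give the first equation of each group in
    \<open>theta_quadrics\<close>; each later block of three is the previous one with all indices
    multiplied by 3.\<close>
  have "t 9 * t 7 * (t 13 * t 1) - t 19 * t 17 * (t 23 * t 11) + t 20 * t 18 * (t 24 * t 10) = 0"
    using theta_three_term[OF q, of 50 48 34 14 12] by (simp add: t_def theta_50_reduce)
  moreover
  have "t 7 * t 5 * (t 15 * t 1) - t 18 * t 16 * (t 24 * t 12) + t 19 * t 17 * (t 23 * t 11) = 0"
    using theta_three_term[OF q, of 50 48 38 16 14] by (simp add: t_def theta_50_reduce)
  moreover
  have "t 8 * t 6 * (t 14 * t 2) - t 18 * t 16 * (t 24 * t 12) + t 20 * t 18 * (t 24 * t 10) = 0"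
    using theta_three_term[OF q, of 50 48 36 16 12] by (simp add: t_def theta_50_reduce)
  moreover
  have "t 17 * t 7 * (t 19 * t 1) - t 20 * t 10 * (t 22 * t 4) + t 21 * t 11 * (t 23 * t 3) = 0"
    using theta_three_term[OF q, of 50 40 26 20 18] by (simp add: t_def theta_50_reduce)
  moreover
  have "t 14 * t 4 * (t 22 * t 2) - t 15 * t 5 * (t 21 * t 3) + t 17 * t 7 * (t 19 * t 1) = 0"
    using theta_three_term[OF q, of 50 40 32 30 26] by (simp add: t_def theta_50_reduce)
  moreover
  have "t 14 * t 4 * (t 22 * t 2) - t 18 * t 8 * (t 24 * t 6) + t 20 * t 10 * (t 22 * t 4) = 0"
    using theta_three_term[OF q, of 50 40 32 24 20] by (simp add: t_def theta_50_reduce)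
  moreover
  have "t 7 * t 3 * (t 21 * t 1) - t 16 * t 12 * (t 20 * t 10) + t 17 * t 13 * (t 19 * t 9) = 0"
    using theta_three_term[OF q, of 50 46 40 22 20] by (simp add: t_def theta_50_reduce)
  moreover
  have "t 7 * t 3 * (t 21 * t 1) - t 12 * t 8 * (t 16 * t 6) + t 13 * t 9 * (t 15 * t 5) = 0"
    using theta_three_term[OF q, of 50 46 40 30 28] by (simp add: t_def theta_50_reduce)
  moreover
  have "t 12 * t 8 * (t 16 * t 6) - t 16 * t 12 * (t 20 * t 10) + t 22 * t 18 * (t 24 * t 4) = 0"
    using theta_three_term[OF q, of 50 46 30 22 10] by (simp add: t_def theta_50_reduce)
  moreover
  have "t 11 * t 7 * (t 23 * t 1) - t 13 * t 9 * (t 21 * t 3) + t 14 * t 10 * (t 20 * t 2) = 0"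
    using theta_three_term[OF q, of 50 46 32 28 26] by (simp add: t_def theta_50_reduce)
  moreover
  have "t 13 * t 9 * (t 21 * t 3) - t 15 * t 11 * (t 23 * t 5) + t 18 * t 14 * (t 24 * t 2) = 0"
    using theta_three_term[OF q, of 50 46 28 24 18] by (simp add: t_def theta_50_reduce)
  moreover
  have "t 14 * t 10 * (t 20 * t 2) - t 16 * t 12 * (t 22 * t 4) + t 18 * t 14 * (t 24 * t 2) = 0"
    using theta_three_term[OF q, of 50 46 26 22 18] by (simp add: t_def theta_50_reduce)
  moreover
  have "t 10 * t 8 * (t 20 * t 6) - t 13 * t 11 * (t 23 * t 9) + t 19 * t 17 * (t 21 * t 3) = 0"
    using theta_three_term[OF q, of 50 48 32 26 14] by (simp add: t_def theta_50_reduce)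
  moreover
  have "t 8 * t 6 * (t 22 * t 4) - t 13 * t 11 * (t 23 * t 9) + t 17 * t 15 * (t 19 * t 5) = 0"
    using theta_three_term[OF q, of 50 48 36 26 18] by (simp add: t_def theta_50_reduce)
  moreover
  have "t 8 * t 6 * (t 22 * t 4) - t 10 * t 8 * (t 20 * t 6) + t 14 * t 12 * (t 16 * t 2) = 0"
    using theta_three_term[OF q, of 50 48 36 32 24] by (simp add: t_def theta_50_reduce)
  ultimately show ?thesis
    unfolding theta_quadrics_def by (intro conjI) (simp_all add: algebra_simps)
qed


text \<open>Links the bracket of \<open>theta_dissection_5\<close> with the sum of the b-variables
  of \<open>theta_quadrics\<close>. After multiplication by \<open>t 6 * t 18 * t 20\<close>, the
  difference of the two sides is a combination of three-term relations with single theta values as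
  coefficients.\<close>

lemma sum_theta_50:
  assumes "t 6 \<noteq> 0" "t 18 \<noteq> 0" "t 20 \<noteq> 0"
  shows "t 2 * t 14 - t 6 * t 8 + t 18 * t 24 - t 4 * t 22 - t 12 * t 16 =
    (t 20)\<^sup>2 - t 10 * t 20 - (t 10)\<^sup>2"
proof -
  have 1: "t 12 * t 10 * (t 14 * t 6) - t 16 * t 14 * (t 18 * t 10) + t 22 * t 20 * (t 24 * t 4) = 0"
    using theta_three_term[OF q, of 50 48 28 20 8] by (simp add: t_def theta_50_reduce)
  have 2: "t 10 * t 8 * (t 16 * t 8) - t 14 * t 12 * (t 20 * t 12) + t 22 * t 20 * (t 22 * t 4) = 0"
    using theta_three_term[OF q, of 50 48 32 24 8] by (simp add: t_def theta_50_reduce)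
  have 3: "t 10 * t 8 * (t 16 * t 4) - t 16 * t 14 * (t 22 * t 10) + t 20 * t 18 * (t 24 * t 6) = 0"
    using theta_three_term[OF q, of 50 48 32 20 12] by (simp add: t_def theta_50_reduce)
  have 4: "t 10 * t 8 * (t 18 * t 6) - t 14 * t 12 * (t 22 * t 10) + t 20 * t 18 * (t 22 * t 4) = 0"
    using theta_three_term[OF q, of 50 48 32 24 12] by (simp add: t_def theta_50_reduce)
  have 5: "t 8 * t 6 * (t 18 * t 6) - t 14 * t 12 * (t 24 * t 12) + t 20 * t 18 * (t 20 * t 6) = 0"
    using theta_three_term[OF q, of 50 48 36 24 12] by (simp add: t_def theta_50_reduce)
  have 6: "t 8 * t 6 * (t 18 * t 6) - t 14 * t 12 * (t 24 * t 12) + t 20 * t 18 * (t 20 * t 6) = 0"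
    using theta_three_term[OF q, of 50 48 36 24 12] by (simp add: t_def theta_50_reduce)
  have 7: "t 16 * t 8 * (t 18 * t 4) - t 18 * t 10 * (t 20 * t 6) + t 22 * t 14 * (t 24 * t 2) = 0"
    using theta_three_term[OF q, of 50 42 26 22 14] by (simp add: t_def theta_50_reduce)
  have 8: "t 12 * t 6 * (t 20 * t 4) - t 16 * t 10 * (t 24 * t 8) + t 20 * t 14 * (t 22 * t 4) = 0"
    using theta_three_term[OF q, of 50 44 32 24 16] by (simp add: t_def theta_50_reduce)
  have 9: "t 8 * t 6 * (t 20 * t 4) - t 14 * t 12 * (t 24 * t 10) + t 18 * t 16 * (t 20 * t 6) = 0"
    using theta_three_term[OF q, of 50 48 36 24 16] by (simp add: t_def theta_50_reduce)
  have 10: "t 18 * t 6 * (t 20 * t 2) - t 20 * t 8 * (t 22 * t 4) + t 22 * t 10 * (t 24 * t 2) = 0"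
    using theta_three_term[OF q, of 50 38 26 22 18] by (simp add: t_def theta_50_reduce)
  have "t 6 * t 18 * t 20 * (t 2 * t 14 - t 6 * t 8 + t 18 * t 24 - t 4 * t 22 - t 12 * t 16 - ((t 20)\<^sup>2 - t 10 * t 20 - (t 10)\<^sup>2)) =
    - t 22 * (t 12 * t 10 * (t 14 * t 6) - t 16 * t 14 * (t 18 * t 10) + t 22 * t 20 * (t 24 * t 4))
    + t 24 * (t 10 * t 8 * (t 16 * t 8) - t 14 * t 12 * (t 20 * t 12) + t 22 * t 20 * (t 22 * t 4))
    + t 18 * (t 10 * t 8 * (t 16 * t 4) - t 16 * t 14 * (t 22 * t 10) + t 20 * t 18 * (t 24 * t 6))
    - t 6 * (t 10 * t 8 * (t 18 * t 6) - t 14 * t 12 * (t 22 * t 10) + t 20 * t 18 * (t 22 * t 4))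
    + t 10 * (t 8 * t 6 * (t 18 * t 6) - t 14 * t 12 * (t 24 * t 12) + t 20 * t 18 * (t 20 * t 6))
    - t 20 * (t 8 * t 6 * (t 18 * t 6) - t 14 * t 12 * (t 24 * t 12) + t 20 * t 18 * (t 20 * t 6))
    - t 10 * (t 16 * t 8 * (t 18 * t 4) - t 18 * t 10 * (t 20 * t 6) + t 22 * t 14 * (t 24 * t 2))
    + t 8 * (t 12 * t 6 * (t 20 * t 4) - t 16 * t 10 * (t 24 * t 8) + t 20 * t 14 * (t 22 * t 4))
    - t 12 * (t 8 * t 6 * (t 20 * t 4) - t 14 * t 12 * (t 24 * t 10) + t 18 * t 16 * (t 20 * t 6))
    + t 14 * (t 18 * t 6 * (t 20 * t 2) - t 20 * t 8 * (t 22 * t 4) + t 22 * t 10 * (t 24 * t 2))"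
    by (simp add: algebra_simps power2_eq_square)
  also have "\<dots> = 0" by (simp only: 1 2 3 4 5 6 7 8 9 10)
  finally show ?thesis using assms by simp
qed

end

section \<open>Generating functions of partitions\<close>

lemma num_partitions_insert:
  assumes "m \<notin> S" "0 \<notin> S" "0 < m"
  shows "num_partitions (insert m S) n =
    num_partitions S n + (if m \<le> n then num_partitions (insert m S) (n - m) else 0)"
proof -
  define X where "X A k = {P :: nat multiset. set_mset P \<subseteq> A \<and> sum_mset P = k}" for A k
  have fin: "finite (X (insert m S) k)" for k
    unfolding X_def using assms by (intro finite_partitions) auto
  have un: "X (insert m S) n = X S n \<union> {P \<in> X (insert m S) n. m \<in># P}"
    by (auto simp: X_def)
  have "finite (X S n)" "finite {P \<in> X (insert m S) n. m \<in># P}"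
    by (rule finite_subset[OF _ fin[of n]], auto simp: X_def)+
  moreover have "X S n \<inter> {P \<in> X (insert m S) n. m \<in># P} = {}"
    using assms by (auto simp: X_def)
  ultimately have "card (X (insert m S) n) = card (X S n) + card {P \<in> X (insert m S) n. m \<in># P}"
    by (subst un) (rule card_Un_disjoint)
  moreover have "{P \<in> X (insert m S) n. m \<in># P} = (if m \<le> n then add_mset m ` X (insert m S) (n - m) else {})"
  proof -
    have "P \<in> add_mset m ` X (insert m S) (n - m) \<and> m \<le> n" if P: "P \<in> X (insert m S) n" "m \<in># P" for P
    proof -
      from multi_member_split[OF P(2)] obtain P' where "P = add_mset m P'" by blast
      thus ?thesis using P(1) by (auto simp: X_def)
    qed
    thus ?thesis by (auto simp: X_def)
  qed
  moreover have "card (add_mset m ` Y) = card Y" for Y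
    by (rule card_image) (auto simp: inj_on_def)
  ultimately show ?thesis
    by (simp add: X_def num_partitions_def)
qed

lemma sums_num_partitions_finite:
  fixes q :: real
  assumes "finite S" "0 \<notin> S" and q: "0 < q" "q < 1"
  shows "(\<lambda>n. real (num_partitions S n) * q ^ n) sums (1 / (\<Prod>m\<in>S. 1 - q ^ m))"
  using assms(1,2)
proof (induction S rule: finite_induct)
  case empty
  have "{P :: nat multiset. set_mset P \<subseteq> {} \<and> sum_mset P = n} = (if n = 0 then {{#}} else {})" for n
    by auto
  hence "num_partitions {} n = (if n = 0 then 1 else 0)" for n
    by (simp add: num_partitions_def)
  hence "(\<lambda>n. real (num_partitions {} n) * q ^ n) = (\<lambda>n. if n = 0 then 1 else 0)"
    by auto
  thus ?case using sums_single[of 0 "\<lambda>_. 1 :: real"] by simp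
next
  case (insert m S)
  define a where "a n = real (num_partitions S n) * q ^ n" for n
  define b where "b n = real (num_partitions (insert m S) n) * q ^ n" for n
  define A where "A = 1 / (\<Prod>m\<in>S. 1 - q ^ m)"
  have m: "m > 0" using insert by (cases m) auto
  have qm: "0 < q ^ m" "q ^ m < 1" using q m by (auto simp: power_less_one_iff)
  have a: "a sums A" using insert by (simp add: a_def[abs_def] A_def)
  have rec: "b n = a n + q ^ m * (if m \<le> n then b (n - m) else 0)" for n
    using num_partitions_insert[of m S n] insert m
    by (auto simp: a_def b_def algebra_simps power_add[symmetric])
  have b0: "b n \<ge> 0" for n using q by (simp add: b_def)
  \<comment> \<open>Convergence for \<open>insert m S\<close> is not known yet. Bounding the shifted
    partial sum by the unshifted one turns the recursion into a uniform bound on partial sums; only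
    then does the recursion determine the value.\<close>
  have shift: "(\<Sum>n<N. if m \<le> n then b (n - m) else 0) \<le> (\<Sum>n<N. b n)" for N
  proof -
    have "(\<Sum>n<N. if m \<le> n then b (n - m) else 0) = (\<Sum>n\<in>{m..<N}. b (n - m))"
      by (rule sum.mono_neutral_cong_right) auto
    also have "\<dots> = (\<Sum>n\<in>{..<N - m}. b n)"
      by (rule sum.reindex_bij_witness[of _ "\<lambda>n. n + m" "\<lambda>n. n - m"]) auto
    also have "\<dots> \<le> (\<Sum>n<N. b n)" by (intro sum_mono2) (auto simp: b0)
    finally show ?thesis .
  qed
  have "summable b"
  proof (rule summableI_nonneg_bounded[OF b0])
    fix N
    have "(\<Sum>n<N. b n) = (\<Sum>n<N. a n) + q ^ m * (\<Sum>n<N. if m \<le> n then b (n - m) else 0)"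
      by (subst rec) (simp add: sum.distrib sum_distrib_left)
    also have "(\<Sum>n<N. a n) \<le> A"
      using a q by (metis a_def mult_nonneg_nonneg of_nat_0_le_iff sum_le_suminf sums_iff zero_le_power
          less_imp_le finite_lessThan)
    also have "q ^ m * (\<Sum>n<N. if m \<le> n then b (n - m) else 0) \<le> q ^ m * (\<Sum>n<N. b n)"
      using shift qm by (intro mult_left_mono) auto
    finally have "(1 - q ^ m) * (\<Sum>n<N. b n) \<le> A" by (simp add: algebra_simps)
    thus "(\<Sum>n<N. b n) \<le> A / (1 - q ^ m)" using qm by (simp add: field_simps)
  qed
  then obtain B where B: "b sums B" by blast
  have "(\<lambda>n. if m \<le> n then b (n - m) else 0) sums B"
  proof -
    have "(\<lambda>n. if m \<le> n + m then b (n + m - m) else 0) sums B" using B by simp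
    hence "(\<lambda>n. if m \<le> n then b (n - m) else 0) sums (B + (\<Sum>n<m. if m \<le> n then b (n - m) else 0))"
      by (rule sums_iff_shift[THEN iffD1])
    thus ?thesis by simp
  qed
  hence "b sums (A + q ^ m * B)"
    using sums_add[OF a sums_mult[of _ B "q ^ m"]] by (subst rec[abs_def]) blast
  hence "B = A + q ^ m * B" using B sums_unique2 by blast
  hence "B = A / (1 - q ^ m)" using qm by (simp add: field_simps)
  moreover have "A / (1 - q ^ m) = 1 / (\<Prod>m\<in>insert m S. 1 - q ^ m)"
    using insert by (simp add: A_def)
  ultimately show ?case using B by (simp add: b_def[abs_def])
qed

text \<open>Restricting S to parts below N leaves the counts for n < N unchanged and never increases
  a count. So the N-th partial sum is at most \<open>1 / P N\<close>, which gives convergence, and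
  \<open>1 / P N\<close> is at most the full sum; the limit is squeezed between them.\<close>

theorem sums_num_partitions:
  fixes q :: real
  assumes S: "0 \<notin> S" and q: "0 < q" "q < 1"
  shows "(\<lambda>n. real (num_partitions S n) * q ^ n) sums (1 / qprod q S)"
proof -
  define P where "P N = (\<Prod>m<N. if m \<in> S then 1 - q ^ m else 1)" for N
  define SN where "SN N = S \<inter> {..<N}" for N
  have "P N = (\<Prod>m\<in>SN N. 1 - q ^ m)" for N
    unfolding P_def SN_def by (subst Int_commute, subst prod.inter_restrict) auto
  moreover have "finite (SN N)" "0 \<notin> SN N" for N using S by (auto simp: SN_def)
  ultimately have sN: "(\<lambda>n. real (num_partitions (SN N) n) * q ^ n) sums (1 / P N)" for N
    using sums_num_partitions_finite[OF _ _ q, of "SN N"] by simp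
  have le: "num_partitions (SN N) n \<le> num_partitions S n" for N n
    unfolding num_partitions_def
    by (rule card_mono[OF finite_partitions[OF S]]) (auto simp: SN_def)
  have eq: "num_partitions (SN N) n = num_partitions S n" if "n < N" for N n
  proof -
    have "m \<le> sum_mset P" if "m \<in># P" for m and P :: "nat multiset"
      using multi_member_split[OF that] by auto
    hence "{P. set_mset P \<subseteq> SN N \<and> sum_mset P = n} = {P. set_mset P \<subseteq> S \<and> sum_mset P = n}"
      using that unfolding SN_def by fastforce
    thus ?thesis by (simp add: num_partitions_def)
  qed
  have lim: "(\<lambda>N. 1 / P N) \<longlonglongrightarrow> 1 / qprod q S"
    unfolding P_def by (intro tendsto_divide tendsto_const qprod_LIMSEQ qprod_nonzero S q)
  have part: "(\<Sum>n<N. real (num_partitions S n) * q ^ n) \<le> 1 / P N" for N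
  proof -
    have "(\<Sum>n<N. real (num_partitions S n) * q ^ n) = (\<Sum>n<N. real (num_partitions (SN N) n) * q ^ n)"
      by (intro sum.cong) (auto simp: eq)
    also have "\<dots> \<le> (\<Sum>n. real (num_partitions (SN N) n) * q ^ n)"
      using sN[of N] q by (intro sum_le_suminf) (auto simp: sums_iff)
    finally show ?thesis using sN[of N] by (simp add: sums_iff)
  qed
  obtain K where K: "\<And>N. norm (1 / P N) \<le> K"
    using convergent_imp_Bseq[OF convergentI[OF lim]] unfolding Bseq_def by blast
  have "summable (\<lambda>n. real (num_partitions S n) * q ^ n)"
  proof (rule summableI_nonneg_bounded)
    show "(\<Sum>n<N. real (num_partitions S n) * q ^ n) \<le> K" for N
      using part[of N] K[of N] abs_ge_self[of "1 / P N"] unfolding real_norm_def by linarith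
  qed (use q in simp)
  then obtain U where U: "(\<lambda>n. real (num_partitions S n) * q ^ n) sums U" by blast
  have "1 / P N \<le> U" for N
    using le q by (intro sums_le[OF _ sN U]) (auto intro!: mult_right_mono)
  hence "(\<lambda>N. 1 / P N) \<longlonglongrightarrow> U"
    using part by (intro tendsto_sandwich[OF _ _ U[unfolded sums_def] tendsto_const]) auto
  hence "U = 1 / qprod q S" using lim LIMSEQ_unique by blast
  thus ?thesis using U by simp
qed

text \<open>Only positive x are available, so coefficients are removed one at a time: once those
  below n vanish, dividing by x^n leaves a series with sum 0 on (0, 1), and the limit at 0 from the
  right forces its constant term to be 0.\<close>

lemma powser_coeffs_eq_0:
  fixes a :: "nat \<Rightarrow> real"
  assumes "\<And>x. 0 < x \<Longrightarrow> x < 1 \<Longrightarrow> (\<lambda>n. a n * x ^ n) sums 0"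
  shows "a n = 0"
proof (induction n rule: less_induct)
  case (less n)
  define c where "c k = a (k + n)" for k
  have c: "(\<lambda>k. c k * x ^ k) sums 0" if x: "0 < x" "x < 1" for x
  proof -
    have "(\<lambda>k. a (k + n) * x ^ (k + n)) sums (0 - (\<Sum>i<n. a i * x ^ i))"
      using assms[OF x] by (subst sums_iff_shift) simp
    also have "(\<Sum>i<n. a i * x ^ i) = 0" using less by simp
    finally have "(\<lambda>k. x ^ n * (c k * x ^ k)) sums (x ^ n * 0)"
      by (simp add: c_def power_add mult_ac)
    thus ?thesis using x by (subst (asm) sums_mult_iff) auto
  qed
  have "summable (\<lambda>k. c k * x ^ k)" if "norm x < 1" for x :: real
  proof -
    from dense[OF that] obtain y where y: "norm x < y" "y < 1" by blast
    hence "summable (\<lambda>k. c k * y ^ k)" using c[of y] norm_ge_zero[of x] by (auto simp: sums_iff)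
    thus ?thesis by (rule powser_inside) (use y in auto)
  qed
  hence "((\<lambda>x. \<Sum>k. c k * x ^ k) \<longlongrightarrow> c 0) (at 0)"
    by (intro powser_limit_0[of 1]) auto
  hence "((\<lambda>x. \<Sum>k. c k * x ^ k) \<longlongrightarrow> c 0) (at_right 0)"
    by (rule tendsto_mono[rotated]) (simp add: at_le)
  moreover have "((\<lambda>x. \<Sum>k. c k * x ^ k) \<longlongrightarrow> 0) (at_right 0)"
  proof (rule Lim_transform_eventually[OF tendsto_const])
    show "\<forall>\<^sub>F x in at_right 0. 0 = (\<Sum>k. c k * x ^ k)"
      using eventually_at_right_less[of 0] eventually_at_right_real[of 0 1] c
      by (auto elim!: eventually_mono simp: sums_iff)
  qed
  ultimately have "c 0 = 0" using tendsto_unique trivial_limit_at_right_real by blast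
  thus ?case by (simp add: c_def)
qed

section \<open>Product identities modulo 50\<close>

text \<open>The product \<open>[r]\<close> of the overview; for r = 0 it runs over the multiples of
  50, each taken once.\<close>

definition pprod :: "real \<Rightarrow> nat \<Rightarrow> real" where
  "pprod q r = qprod q (pm_residue_class {int r} 50)"

lemma pm_residue_class_single:
  assumes "r < M"
  shows "pm_residue_class {int r} (int M) = {n. n > 0 \<and> n mod M \<in> {r, (M - r) mod M}}"
proof -
  have "[int n = - int r] (mod int M) \<longleftrightarrow> n mod M = (M - r) mod M" for n
  proof -
    have "[int n = - int r] (mod int M) \<longleftrightarrow> [int n = int M - int r] (mod int M)"
      by (simp add: cong_def)
    also have "\<dots> \<longleftrightarrow> [n = M - r] (mod M)"
      using assms by (simp add: cong_int_iff[symmetric] of_nat_diff)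
    finally show ?thesis by (simp add: cong_def)
  qed
  moreover have "[int n = int r] (mod int M) \<longleftrightarrow> n mod M = r" for n
    using assms by (simp add: cong_int_iff) (simp add: cong_def)
  ultimately show ?thesis by (auto simp: pm_residue_class_def)
qed

lemma pm_residue_class_insert:
  "pm_residue_class (insert r R) M = pm_residue_class {r} M \<union> pm_residue_class R M"
  by (auto simp: pm_residue_class_def)

lemma qprod_pm_residue_class:
  assumes q: "0 < q" "q < 1" and R: "finite R" "R \<subseteq> {..<25}"
  shows "qprod q (pm_residue_class (int ` R) 50) = (\<Prod>r\<in>R. pprod q r)"
  using R
proof (induction R rule: finite_induct)
  case empty
  show ?case by (simp add: qprod_def pm_residue_class_def)
next
  case (insert r R)
  have "pm_residue_class {int r} 50 \<inter> pm_residue_class (int ` R) 50 = {}"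
  proof -
    have "pm_residue_class {int r} 50 \<inter> pm_residue_class {int s} 50 = {}" if "s \<in> R" for s
    proof -
      have *: "s \<noteq> r" "r < 25" "s < 25" using that insert by auto
      have **: "(50 - u) mod 50 = (if u = 0 then 0 else 50 - u)" if "u < 25" for u :: nat
        using that by simp
      have "pm_residue_class {int u} 50 = {n. n > 0 \<and> n mod 50 \<in> {u, if u = 0 then 0 else 50 - u}}"
        if "u < 25" for u
        using pm_residue_class_single[of u 50] that by (simp only: **) simp
      hence "pm_residue_class {int r} 50 \<inter> pm_residue_class {int s} 50 =
          {n. n > 0 \<and> n mod 50 \<in> {r, if r = 0 then 0 else 50 - r} \<and> n mod 50 \<in> {s, if s = 0 then 0 else 50 - s}}"
        using * by blast
      also have "{r, if r = 0 then 0 else 50 - r} \<inter> {s, if s = 0 then 0 else 50 - s} = {}"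
        using * by (auto split: if_splits)
      hence "{n. n > 0 \<and> n mod 50 \<in> {r, if r = 0 then 0 else 50 - r} \<and> n mod 50 \<in> {s, if s = 0 then 0 else 50 - s}} = {}"
        by blast
      finally show ?thesis .
    qed
    moreover have "pm_residue_class (int ` R) 50 = (\<Union>s\<in>R. pm_residue_class {int s} 50)"
      by (auto simp: pm_residue_class_def)
    ultimately show ?thesis by blast
  qed
  thus ?case using insert
    by (simp add: pm_residue_class_insert[of _ "int ` R"] qprod_Un[OF q] zero_notin_pm_residue_class pprod_def)
qed

lemma pprod_nonzero: "0 < q \<Longrightarrow> q < 1 \<Longrightarrow> pprod q r \<noteq> 0"
  unfolding pprod_def by (intro qprod_nonzero zero_notin_pm_residue_class)

lemma theta_50_eq_pprod:
  assumes q: "0 < q" "q < 1" and r: "0 < r" "r < 25"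
  shows "theta q 50 (real r) = q powr ((real r - 25)\<^sup>2 / 100) * (pprod q 0 * pprod q r)"
proof -
  have "pm_residue_class (int ` {0, r}) 50 = pm_residue_class {int 0} (int 50) \<union> pm_residue_class {int r} (int 50)"
    using pm_residue_class_insert[of "int 0" "{int r}" 50] by simp
  also have "\<dots> = {m. m > 0 \<and> m mod 50 \<in> {0, (50 - 0) mod 50}} \<union> {m. m > 0 \<and> m mod 50 \<in> {r, (50 - r) mod 50}}"
    using r by (subst (1 2) pm_residue_class_single) auto
  also have "\<dots> = {m. m > 0 \<and> m mod 50 \<in> {0, r, 50 - r}}"
    using r by auto
  finally have "{m. m > 0 \<and> m mod 50 \<in> {0, r, 50 - r}} = pm_residue_class (int ` {0, r}) 50" ..
  hence "qprod q {m. m > 0 \<and> m mod 50 \<in> {0, r, 50 - r}} = pprod q 0 * pprod q r"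
    using qprod_pm_residue_class[OF q, of "{0, r}"] r by simp
  thus ?thesis using qprod_eq_theta[OF q, of r 50] r by simp
qed

text \<open>The residues 0, 2, 4 modulo 6 are all even numbers, so this is Euler's product in q^2.
  It is regrouped here by even residues modulo 50.\<close>

lemma theta_6_eq_pprod:
  assumes q: "0 < q" "q < 1"
  shows "theta q 6 2 = q powr (1 / 12) * (\<Prod>r\<in>{0, 2, 4, 6, 8, 10, 12, 14, 16, 18, 20, 22, 24}. pprod q r)"
proof -
  define R where "R = {r \<in> {..<25::nat}. even r}"
  have R: "R = {0, 2, 4, 6, 8, 10, 12, 14, 16, 18, 20, 22, 24}"
    unfolding R_def by (auto simp: lessThan_nat_numeral)
  have "{m. m > 0 \<and> m mod 6 \<in> {0, 2, 6 - 2}} = {m :: nat. m > 0 \<and> even m}"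
    by (rule Collect_cong) (simp, presburger)
  also have "\<dots> = (\<Union>r\<in>R. pm_residue_class {int r} 50)"
  proof -
    have "even m \<longleftrightarrow> (\<exists>r\<in>R. m mod 50 \<in> {r, (50 - r) mod 50})" for m :: nat
    proof
      assume "even m"
      hence *: "even (m mod 50)" by presburger
      show "\<exists>r\<in>R. m mod 50 \<in> {r, (50 - r) mod 50}"
      proof (cases "m mod 50 < 25")
        case True
        thus ?thesis using * by (auto simp: R_def)
      next
        case False
        define k where "k = m mod 50"
        have "k < 50" by (simp add: k_def)
        moreover have "k \<noteq> 25" using * by (auto simp: k_def)
        ultimately have "50 - k \<in> R" "k = (50 - (50 - k)) mod 50"
          using False * by (auto simp: R_def k_def)
        thus ?thesis unfolding k_def by blast
      qed
    next
      assume "\<exists>r\<in>R. m mod 50 \<in> {r, (50 - r) mod 50}"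
      then obtain r where r: "r < 25" "even r" "m mod 50 = r \<or> m mod 50 = (50 - r) mod 50"
        by (auto simp: R_def)
      have "(50 - r) mod 50 = (if r = 0 then 0 else 50 - r)" using r(1) by simp
      hence "even (m mod 50)" using r by (auto split: if_splits)
      thus "even m" by presburger
    qed
    moreover have "pm_residue_class {int r} 50 = {n. n > 0 \<and> n mod 50 \<in> {r, (50 - r) mod 50}}" if "r \<in> R" for r
      using pm_residue_class_single[of r 50] that by (simp add: R_def)
    ultimately show ?thesis by auto
  qed
  also have "\<dots> = pm_residue_class (int ` R) 50"
    by (auto simp: pm_residue_class_def)
  finally have "qprod q {m. m > 0 \<and> m mod 6 \<in> {0, 2, 6 - 2}} = (\<Prod>r\<in>R. pprod q r)"
    using qprod_pm_residue_class[OF q, of R] by (simp only: R_def) auto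
  thus ?thesis
    using qprod_eq_theta[OF q, of 2 6] unfolding R by simp
qed

lemma theta_150_eq_pprod:
  assumes q: "0 < q" "q < 1"
  shows "theta q 150 50 = q powr (25 / 12) * pprod q 0"
proof -
  have "{m. m > 0 \<and> m mod 150 \<in> {0, 50, 150 - 50}} = pm_residue_class {int 0} 50"
  proof -
    have "m mod 150 \<in> {0, 50, 150 - 50} \<longleftrightarrow> m mod 50 = 0" for m :: nat
    proof -
      have "k \<in> {0, 50, 150 - 50} \<longleftrightarrow> k mod 50 = 0" if "k < 150" for k :: nat
        using that by (auto elim!: dvdE)
      from this[of "m mod 150"] show ?thesis by (simp add: mod_mod_cancel)
    qed
    thus ?thesis using pm_residue_class_single[of 0 50] by simp
  qed
  thus ?thesis
    using qprod_eq_theta[OF q, of 50 150] by (simp add: pprod_def power2_eq_square)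
qed

text \<open>The term \<open>q ^ j\<close> accounts for the single n at which the counts disagree: j
  = 0 in four of the claims, where the empty partition has no counterpart, and j = 5 with k = 0 in
  the third.\<close>

lemma num_partitions_shift:
  assumes "0 \<notin> S" "0 \<notin> T"
    and id: "\<And>q::real. 0 < q \<Longrightarrow> q < 1 \<Longrightarrow> 1 / qprod q S = q ^ k * (1 / qprod q T) + q ^ j"
  shows "real (num_partitions S n) =
    (if k \<le> n then real (num_partitions T (n - k)) else 0) + (if n = j then 1 else 0)"
proof -
  have "real (num_partitions S n) -
      ((if k \<le> n then real (num_partitions T (n - k)) else 0) + (if n = j then 1 else 0)) = 0"
  proof (rule powser_coeffs_eq_0[where n = n and a = "\<lambda>n. real (num_partitions S n) -
      ((if k \<le> n then real (num_partitions T (n - k)) else 0) + (if n = j then 1 else 0))"])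
    fix q :: real assume q: "0 < q" "q < 1"
    have "(\<lambda>n. if k \<le> n + k then real (num_partitions T (n + k - k)) * q ^ (n + k) else 0) sums (q ^ k * (1 / qprod q T))"
      using sums_mult[OF sums_num_partitions[OF assms(2) q], of "q ^ k"] by (simp add: power_add mult_ac)
    hence "(\<lambda>n. if k \<le> n then real (num_partitions T (n - k)) * q ^ n else 0) sums
        (q ^ k * (1 / qprod q T) + (\<Sum>n<k. if k \<le> n then real (num_partitions T (n - k)) * q ^ n else 0))"
      by (rule sums_iff_shift[THEN iffD1])
    hence "(\<lambda>n. if k \<le> n then real (num_partitions T (n - k)) * q ^ n else 0) sums (q ^ k * (1 / qprod q T))"
      by simp
    moreover have "(\<lambda>n. if n = j then q ^ n else 0) sums q ^ j" by (rule sums_single)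
    ultimately have "(\<lambda>n. real (num_partitions S n) * q ^ n -
        ((if k \<le> n then real (num_partitions T (n - k)) * q ^ n else 0) + (if n = j then q ^ n else 0)))
        sums (1 / qprod q S - (q ^ k * (1 / qprod q T) + q ^ j))"
      by (intro sums_diff sums_add sums_num_partitions assms q)
    also have "(\<lambda>n. real (num_partitions S n) * q ^ n -
        ((if k \<le> n then real (num_partitions T (n - k)) * q ^ n else 0) + (if n = j then q ^ n else 0))) =
        (\<lambda>n. (real (num_partitions S n) -
        ((if k \<le> n then real (num_partitions T (n - k)) else 0) + (if n = j then 1 else 0))) * q ^ n)"
      by (auto simp: algebra_simps)
    finally show "(\<lambda>n. (real (num_partitions S n) -
        ((if k \<le> n then real (num_partitions T (n - k)) else 0) + (if n = j then 1 else 0))) * q ^ n) sums 0"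
      using id[OF q] by simp
  qed
  thus ?thesis by simp
qed

text \<open>The divisibility by 50 is available whenever s is 7r or -7r modulo 50, since r^2 + 49
  r^2 = 50 r^2 and r, s have the same parity. The fractional exponents of a pair then add up to a
  multiple of 1/2.\<close>

lemma theta_50_pair:
  assumes q: "0 < q" "q < 1" and "0 < r" "r < 25" "0 < s" "s < 25" and n: "(25 - r)\<^sup>2 + (25 - s)\<^sup>2 = 50 * n"
  shows "theta q 50 (real r) * theta q 50 (real s) = sqrt q ^ n * ((pprod q 0)\<^sup>2 * (pprod q r * pprod q s))"
proof -
  have "(real r - 25)\<^sup>2 + (real s - 25)\<^sup>2 = real ((25 - r)\<^sup>2 + (25 - s)\<^sup>2)"
    using assms(4,6) by (simp add: of_nat_diff power2_commute)
  hence "(real r - 25)\<^sup>2 / 100 + (real s - 25)\<^sup>2 / 100 = 1 / 2 * real n" unfolding n by simp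
  hence "q powr ((real r - 25)\<^sup>2 / 100) * q powr ((real s - 25)\<^sup>2 / 100) = sqrt q ^ n"
    using q by (simp only: powr_add[symmetric] powr_powr[symmetric] powr_half_sqrt powr_realpow real_sqrt_gt_zero less_imp_le)
  thus ?thesis
    unfolding theta_50_eq_pprod[OF q assms(3,4)] theta_50_eq_pprod[OF q assms(5,6)]
    by (simp add: power2_eq_square mult_ac)
qed

text \<open>Each variable is written as a signed power of q (lower case) times the common factor
  \<open>J\<^sup>2\<close> times a pair of products (upper case). Assumption \<open>s\<close>
  replaces the sum of the b's by a product, after which \<open>J ^ 10 * Y0 * Y3 * G * g\<close>
  cancels. What remains has two pairs in the terms of the first summand but eight in the second,
  hence the degrees 4 and 16.\<close>

lemma theta_quadrics_identity_cancel:
  fixes J :: real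
  assumes rel: "theta_quadrics a0 a1 a2 a3 a4 b0 b1 b2 b3 b4 f g"
    and s: "q\<^sup>2 * (b0 + b1 + b2 + b3 + b4) = Y0 * Y1 * Y2 * Y3 * Y4 * G * g"
    and eqs: "a0 = x0 * (J\<^sup>2 * X0)" "a2 = x2 * (J\<^sup>2 * X2)" "a3 = x3 * (J\<^sup>2 * X3)" "a4 = x4 * (J\<^sup>2 * X4)"
      "b0 = y0 * (J\<^sup>2 * Y0)" "b2 = y2 * (J\<^sup>2 * Y2)" "b3 = y3 * (J\<^sup>2 * Y3)" "b4 = y4 * (J\<^sup>2 * Y4)"
      "f = z * (J\<^sup>2 * F)" "g = w * (J\<^sup>2 * G)"
    and nz: "g \<noteq> 0" "b0 \<noteq> 0" "b1 \<noteq> 0" "b3 \<noteq> 0"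
  shows "y0 * y3 * w * q\<^sup>2 * (z * y2 * (F * Y2) - x2 * y4 * (X2 * Y4)) +
    x0 * x2 * x3 * x4 * z * (F * X0 * X2 * X3 * X4 * Y1 * Y2 * Y4) = 0" (is "?L = 0")
proof -
  have "J ^ 10 * Y0 * Y3 * G * g * ?L =
      b0 * b3 * (f * b2 - a2 * b4) * g * g * q\<^sup>2 +
      a0 * a2 * a3 * a4 * f * (Y0 * Y1 * Y2 * Y3 * Y4 * G * g)"
    unfolding eqs by algebra
  also have "\<dots> = q\<^sup>2 * (b0 * b3 * (f * b2 - a2 * b4) * g\<^sup>2 + a0 * a2 * a3 * a4 * f * (b0 + b1 + b2 + b3 + b4))"
    unfolding s[symmetric] by algebra
  also have "\<dots> = 0" using theta_quadrics_identity[OF rel nz] by simp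
  finally show ?thesis using nz eqs by auto
qed

theorem product_identities:
  fixes q :: real
  assumes q: "0 < q" "q < 1"
  defines "P \<equiv> pprod q"
  shows "P 5 * P 15 * (P 18 * P 24) - q * (P 9 * P 13 * (P 12 * P 16)) =
      P 5 * P 15 * (P 1 * P 7) * (P 9 * P 13) * (P 11 * P 23) * (P 17 * P 19) * (P 6 * P 8) * (P 18 * P 24) * (P 12 * P 16)"
    and "P 11 * P 23 * (P 2 * P 14) - q * (P 5 * P 15 * (P 4 * P 22)) =
      P 5 * P 15 * (P 3 * P 21) * (P 11 * P 23) * (P 17 * P 19) * (P 1 * P 7) * (P 18 * P 24) * (P 4 * P 22) * (P 2 * P 14)"
    and "P 17 * P 19 * (P 6 * P 8) - P 5 * P 15 * (P 12 * P 16) =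
      q ^ 5 * (P 5 * P 15 * (P 9 * P 13) * (P 17 * P 19) * (P 1 * P 7) * (P 3 * P 21) * (P 4 * P 22) * (P 12 * P 16) * (P 6 * P 8))"
    and "P 1 * P 7 * (P 18 * P 24) - q\<^sup>2 * (P 5 * P 15 * (P 2 * P 14)) =
      P 5 * P 15 * (P 11 * P 23) * (P 1 * P 7) * (P 3 * P 21) * (P 9 * P 13) * (P 12 * P 16) * (P 2 * P 14) * (P 18 * P 24)"
    and "P 3 * P 21 * (P 4 * P 22) - q\<^sup>2 * (P 5 * P 15 * (P 6 * P 8)) =
      P 5 * P 15 * (P 17 * P 19) * (P 3 * P 21) * (P 9 * P 13) * (P 11 * P 23) * (P 2 * P 14) * (P 6 * P 8) * (P 4 * P 22)"
proof -
  \<comment> \<open>The pairs with even indices carry odd powers of the square root of q, so all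
    exponents are counted in \<open>h\<close>.\<close>
  define h where "h = sqrt q"
  have h: "h \<noteq> 0" "q = h\<^sup>2" using q by (auto simp: h_def)
  define t where "t = theta q 50"
  have t_nz: "t (real r) \<noteq> 0" if "0 < r" "r < 25" for r
    using q that by (simp add: t_def theta_50_eq_pprod pprod_nonzero)
  note t_nzs = t_nz[of 2, simplified] t_nz[of 4, simplified] t_nz[of 6, simplified] t_nz[of 8, simplified]
    t_nz[of 10, simplified] t_nz[of 12, simplified] t_nz[of 14, simplified] t_nz[of 16, simplified]
    t_nz[of 18, simplified] t_nz[of 20, simplified] t_nz[of 22, simplified] t_nz[of 24, simplified]
  have pair: "t (real r) * t (real s) = h ^ n * ((P 0)\<^sup>2 * (P r * P s))"
    if "0 < r" "r < 25" "0 < s" "s < 25" "(25 - r)\<^sup>2 + (25 - s)\<^sup>2 = 50 * n" for r s n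
    unfolding t_def h_def P_def using theta_50_pair[OF q that] .
  have a0: "t 1 * t 7 = h ^ 18 * ((P 0)\<^sup>2 * (P 1 * P 7))"
    using pair[of 1 7 18] by simp
  have a1: "t 3 * t 21 = h ^ 10 * ((P 0)\<^sup>2 * (P 3 * P 21))"
    using pair[of 3 21 10] by simp
  have a2: "- (t 9 * t 13) = - (h ^ 8) * ((P 0)\<^sup>2 * (P 9 * P 13))"
    using pair[of 9 13 8] by simp
  have a3: "- (t 11 * t 23) = - (h ^ 4) * ((P 0)\<^sup>2 * (P 11 * P 23))"
    using pair[of 11 23 4] by simp
  have a4: "t 17 * t 19 = h ^ 2 * ((P 0)\<^sup>2 * (P 17 * P 19))"
    using pair[of 17 19 2] by simp
  have b0: "t 2 * t 14 = h ^ 13 * ((P 0)\<^sup>2 * (P 2 * P 14))"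
    using pair[of 2 14 13] by simp
  have b1: "- (t 6 * t 8) = - (h ^ 13) * ((P 0)\<^sup>2 * (P 6 * P 8))"
    using pair[of 6 8 13] by simp
  have b2: "t 18 * t 24 = h * ((P 0)\<^sup>2 * (P 18 * P 24))"
    using pair[of 18 24 1] by simp
  have b3: "- (t 4 * t 22) = - (h ^ 9) * ((P 0)\<^sup>2 * (P 4 * P 22))"
    using pair[of 4 22 9] by simp
  have b4: "- (t 12 * t 16) = - (h ^ 5) * ((P 0)\<^sup>2 * (P 12 * P 16))"
    using pair[of 12 16 5] by simp
  have f: "t 5 * t 15 = h ^ 10 * ((P 0)\<^sup>2 * (P 5 * P 15))"
    using pair[of 5 15 10] by simp
  have g: "t 10 * t 20 = h ^ 5 * ((P 0)\<^sup>2 * (P 10 * P 20))"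
    using pair[of 10 20 5] by simp
  define s where "s = t 2 * t 14 + - (t 6 * t 8) + t 18 * t 24 + - (t 4 * t 22) + - (t 12 * t 16)"
  have s: "q\<^sup>2 * s = (P 2 * P 14) * (P 6 * P 8) * (P 18 * P 24) * (P 4 * P 22) * (P 12 * P 16) * (P 10 * P 20) * (t 10 * t 20)"
  proof -
    have "s = (t 20)\<^sup>2 - t 10 * t 20 - (t 10)\<^sup>2"
      using sum_theta_50[OF q] t_nzs by (simp add: s_def t_def)
    hence "theta q 6 2 * (t 10 * t 20) = theta q 150 50 * s"
      using theta_dissection_5[OF q] by (simp add: t_def)
    \<comment> \<open>The prefactors q^(25/12) and q^(1/12) of the two series differ by q^2, the
      source of the \<open>q\<^sup>2\<close> in \<open>s\<close>.\<close>
    moreover have "theta q 150 50 = q powr (1 / 12) * (q\<^sup>2 * P 0)"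
    proof -
      have "q powr (25 / 12) = q powr (1 / 12 + 2)" by simp
      also have "\<dots> = q powr (1 / 12) * q\<^sup>2"
        using q by (subst powr_add) (simp add: powr_numeral)
      finally show ?thesis by (simp add: theta_150_eq_pprod[OF q] P_def)
    qed
    moreover have "theta q 6 2 = q powr (1 / 12) * (P 0 * ((P 2 * P 14) * (P 6 * P 8) * (P 18 * P 24) * (P 4 * P 22) * (P 12 * P 16) * (P 10 * P 20)))"
      by (simp add: theta_6_eq_pprod[OF q] P_def mult_ac)
    ultimately show ?thesis
      using q pprod_nonzero[OF q, of 0] by (simp add: P_def mult_ac)
  qed
  note rel0 = theta_quadrics_theta_50[OF q, folded t_def]
  note rel1 = theta_quadrics_rotate[OF rel0]
  note rel2 = theta_quadrics_rotate[OF rel1]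
  note rel3 = theta_quadrics_rotate[OF rel2]
  note rel4 = theta_quadrics_rotate[OF rel3]
  have "q\<^sup>2 * (t 2 * t 14 + - (t 6 * t 8) + t 18 * t 24 + - (t 4 * t 22) + - (t 12 * t 16)) =
      (P 2 * P 14) * (P 6 * P 8) * (P 18 * P 24) * (P 4 * P 22) * (P 12 * P 16) * (P 10 * P 20) * (t 10 * t 20)"
    using s by (simp add: s_def algebra_simps)
  note id0 = theta_quadrics_identity_cancel[OF rel0 this a0 a2 a3 a4 b0 b2 b3 b4 f g, unfolded h(2)]
  have "q\<^sup>2 * (- (t 6 * t 8) + t 18 * t 24 + - (t 4 * t 22) + - (t 12 * t 16) + t 2 * t 14) =
      (P 6 * P 8) * (P 18 * P 24) * (P 4 * P 22) * (P 12 * P 16) * (P 2 * P 14) * (P 10 * P 20) * (t 10 * t 20)"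
    using s by (simp add: s_def algebra_simps)
  note id1 = theta_quadrics_identity_cancel[OF rel1 this a1 a3 a4 a0 b1 b3 b4 b0 f g, unfolded h(2)]
  have "q\<^sup>2 * (t 18 * t 24 + - (t 4 * t 22) + - (t 12 * t 16) + t 2 * t 14 + - (t 6 * t 8)) =
      (P 18 * P 24) * (P 4 * P 22) * (P 12 * P 16) * (P 2 * P 14) * (P 6 * P 8) * (P 10 * P 20) * (t 10 * t 20)"
    using s by (simp add: s_def algebra_simps)
  note id2 = theta_quadrics_identity_cancel[OF rel2 this a2 a4 a0 a1 b2 b4 b0 b1 f g, unfolded h(2)]
  have "q\<^sup>2 * (- (t 4 * t 22) + - (t 12 * t 16) + t 2 * t 14 + - (t 6 * t 8) + t 18 * t 24) =
      (P 4 * P 22) * (P 12 * P 16) * (P 2 * P 14) * (P 6 * P 8) * (P 18 * P 24) * (P 10 * P 20) * (t 10 * t 20)"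
    using s by (simp add: s_def algebra_simps)
  note id3 = theta_quadrics_identity_cancel[OF rel3 this a3 a0 a1 a2 b3 b0 b1 b2 f g, unfolded h(2)]
  have "q\<^sup>2 * (- (t 12 * t 16) + t 2 * t 14 + - (t 6 * t 8) + t 18 * t 24 + - (t 4 * t 22)) =
      (P 12 * P 16) * (P 2 * P 14) * (P 6 * P 8) * (P 18 * P 24) * (P 4 * P 22) * (P 10 * P 20) * (t 10 * t 20)"
    using s by (simp add: s_def algebra_simps)
  note id4 = theta_quadrics_identity_cancel[OF rel4 this a4 a1 a2 a3 b4 b1 b2 b3 f g, unfolded h(2)]
  \<comment> \<open>The extracted power is the least exponent of h among the three terms. Here 42 =
    13 + 9 + 5 + 4 + 10 + 1 = 18 + 8 + 4 + 2 + 10, while the middle term has 44, which leaves the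
    shift by q.\<close>
  have id0': "h ^ 42 * (P 5 * P 15 * (P 18 * P 24) - h\<^sup>2 * (P 9 * P 13 * (P 12 * P 16)) -
      P 5 * P 15 * (P 1 * P 7) * (P 9 * P 13) * (P 11 * P 23) * (P 17 * P 19) * (P 6 * P 8) * (P 18 * P 24) * (P 12 * P 16)) = 0"
    using id0 t_nzs by (simp add: algebra_simps power_numeral_reduce)
  have id1': "h ^ 44 * (P 11 * P 23 * (P 2 * P 14) - h\<^sup>2 * (P 5 * P 15 * (P 4 * P 22)) -
      P 5 * P 15 * (P 3 * P 21) * (P 11 * P 23) * (P 17 * P 19) * (P 1 * P 7) * (P 18 * P 24) * (P 4 * P 22) * (P 2 * P 14)) = 0"
    using id1 t_nzs by (simp add: algebra_simps power_numeral_reduce)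
  \<comment> \<open>Here the first two terms carry the same power of h and the third has ten more:
    there is no shift, and the exception moves to n = 5.\<close>
  have id2': "h ^ 38 * (P 17 * P 19 * (P 6 * P 8) - P 5 * P 15 * (P 12 * P 16) -
      h ^ 10 * (P 5 * P 15 * (P 9 * P 13) * (P 17 * P 19) * (P 1 * P 7) * (P 3 * P 21) * (P 4 * P 22) * (P 12 * P 16) * (P 6 * P 8))) = 0"
    using id2 t_nzs by (simp add: algebra_simps power_numeral_reduce)
  have id3': "h ^ 50 * (P 1 * P 7 * (P 18 * P 24) - h ^ 4 * (P 5 * P 15 * (P 2 * P 14)) -
      P 5 * P 15 * (P 11 * P 23) * (P 1 * P 7) * (P 3 * P 21) * (P 9 * P 13) * (P 12 * P 16) * (P 2 * P 14) * (P 18 * P 24)) = 0"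
    using id3 t_nzs by (simp add: algebra_simps power_numeral_reduce)
  have id4': "h ^ 34 * (P 3 * P 21 * (P 4 * P 22) - h ^ 4 * (P 5 * P 15 * (P 6 * P 8)) -
      P 5 * P 15 * (P 17 * P 19) * (P 3 * P 21) * (P 9 * P 13) * (P 11 * P 23) * (P 2 * P 14) * (P 6 * P 8) * (P 4 * P 22)) = 0"
    using id4 t_nzs by (simp add: algebra_simps power_numeral_reduce)
  show "P 5 * P 15 * (P 18 * P 24) - q * (P 9 * P 13 * (P 12 * P 16)) =
      P 5 * P 15 * (P 1 * P 7) * (P 9 * P 13) * (P 11 * P 23) * (P 17 * P 19) * (P 6 * P 8) * (P 18 * P 24) * (P 12 * P 16)"
    using id0' h by simp
  show "P 11 * P 23 * (P 2 * P 14) - q * (P 5 * P 15 * (P 4 * P 22)) =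
      P 5 * P 15 * (P 3 * P 21) * (P 11 * P 23) * (P 17 * P 19) * (P 1 * P 7) * (P 18 * P 24) * (P 4 * P 22) * (P 2 * P 14)"
    using id1' h by simp
  show "P 17 * P 19 * (P 6 * P 8) - P 5 * P 15 * (P 12 * P 16) =
      q ^ 5 * (P 5 * P 15 * (P 9 * P 13) * (P 17 * P 19) * (P 1 * P 7) * (P 3 * P 21) * (P 4 * P 22) * (P 12 * P 16) * (P 6 * P 8))"
    using id2' h by (simp flip: power_mult)
  show "P 1 * P 7 * (P 18 * P 24) - q\<^sup>2 * (P 5 * P 15 * (P 2 * P 14)) =
      P 5 * P 15 * (P 11 * P 23) * (P 1 * P 7) * (P 3 * P 21) * (P 9 * P 13) * (P 12 * P 16) * (P 2 * P 14) * (P 18 * P 24)"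
    using id3' h by (simp flip: power_mult)
  show "P 3 * P 21 * (P 4 * P 22) - q\<^sup>2 * (P 5 * P 15 * (P 6 * P 8)) =
      P 5 * P 15 * (P 17 * P 19) * (P 3 * P 21) * (P 9 * P 13) * (P 11 * P 23) * (P 2 * P 14) * (P 6 * P 8) * (P 4 * P 22)"
    using id4' h by (simp flip: power_mult)
qed

text \<open>Used with c the product over the eight residues common to S and T, and u, v the products
  over the four residues only in S and only in T; the product identity is divided by
  \<open>c * u * v\<close>.\<close>

lemma reciprocal_identity:
  fixes u v c k e :: real
  assumes "v - k * u = e * (c * u * v)" "c \<noteq> 0" "u \<noteq> 0" "v \<noteq> 0"
  shows "1 / (c * u) = k * (1 / (c * v)) + e"
proof -
  have "v = k * u + e * (c * u * v)" using assms(1) by simp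
  hence "v / (c * u * v) = (k * u + e * (c * u * v)) / (c * u * v)" by simp
  thus ?thesis using assms(2-4) by (simp add: add_divide_distrib)
qed

section \<open>The five partition identities, including the exceptional values of n\<close>

lemma num_partitions_identity_i:
  "real (num_partitions (pm_residue_class {1, 6, 7, 8, 9, 11, 12, 13, 16, 17, 19, 23} 50) n) =
    (if 1 \<le> n then real (num_partitions (pm_residue_class {1, 5, 6, 7, 8, 11, 15, 17, 18, 19, 23, 24} 50) (n - 1)) else 0) + (if n = 0 then 1 else 0)"
proof (rule num_partitions_shift)
  fix q :: real assume q: "0 < q" "q < 1"
  have "1 / ((\<Prod>r\<in>{1, 6, 7, 8, 11, 17, 19, 23}. pprod q r) * (\<Prod>r\<in>{9, 12, 13, 16}. pprod q r)) = q ^ 1 * (1 / ((\<Prod>r\<in>{1, 6, 7, 8, 11, 17, 19, 23}. pprod q r) * (\<Prod>r\<in>{5, 15, 18, 24}. pprod q r))) + q ^ 0"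
    using product_identities(1)[OF q] pprod_nonzero[OF q]
    by (intro reciprocal_identity) (simp_all add: mult_ac)
  thus "1 / qprod q (pm_residue_class {1, 6, 7, 8, 9, 11, 12, 13, 16, 17, 19, 23} 50) = q ^ 1 * (1 / qprod q (pm_residue_class {1, 5, 6, 7, 8, 11, 15, 17, 18, 19, 23, 24} 50)) + q ^ 0"
    using qprod_pm_residue_class[OF q, of "{1, 6, 7, 8, 9, 11, 12, 13, 16, 17, 19, 23}"] qprod_pm_residue_class[OF q, of "{1, 5, 6, 7, 8, 11, 15, 17, 18, 19, 23, 24}"]
    by (simp add: mult_ac)
qed (rule zero_notin_pm_residue_class)+

lemma num_partitions_identity_ii:
  "real (num_partitions (pm_residue_class {1, 3, 4, 5, 7, 15, 17, 18, 19, 21, 22, 24} 50) n) =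
    (if 1 \<le> n then real (num_partitions (pm_residue_class {1, 2, 3, 7, 11, 14, 17, 18, 19, 21, 23, 24} 50) (n - 1)) else 0) + (if n = 0 then 1 else 0)"
proof (rule num_partitions_shift)
  fix q :: real assume q: "0 < q" "q < 1"
  have "1 / ((\<Prod>r\<in>{1, 3, 7, 17, 18, 19, 21, 24}. pprod q r) * (\<Prod>r\<in>{4, 5, 15, 22}. pprod q r)) = q ^ 1 * (1 / ((\<Prod>r\<in>{1, 3, 7, 17, 18, 19, 21, 24}. pprod q r) * (\<Prod>r\<in>{2, 11, 14, 23}. pprod q r))) + q ^ 0"
    using product_identities(2)[OF q] pprod_nonzero[OF q]
    by (intro reciprocal_identity) (simp_all add: mult_ac)
  thus "1 / qprod q (pm_residue_class {1, 3, 4, 5, 7, 15, 17, 18, 19, 21, 22, 24} 50) = q ^ 1 * (1 / qprod q (pm_residue_class {1, 2, 3, 7, 11, 14, 17, 18, 19, 21, 23, 24} 50)) + q ^ 0"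
    using qprod_pm_residue_class[OF q, of "{1, 3, 4, 5, 7, 15, 17, 18, 19, 21, 22, 24}"] qprod_pm_residue_class[OF q, of "{1, 2, 3, 7, 11, 14, 17, 18, 19, 21, 23, 24}"]
    by (simp add: mult_ac)
qed (rule zero_notin_pm_residue_class)+

lemma num_partitions_identity_iii:
  "real (num_partitions (pm_residue_class {1, 3, 4, 5, 7, 9, 12, 13, 15, 16, 21, 22} 50) n) =
    (if 0 \<le> n then real (num_partitions (pm_residue_class {1, 3, 4, 6, 7, 8, 9, 13, 17, 19, 21, 22} 50) (n - 0)) else 0) + (if n = 5 then 1 else 0)"
proof (rule num_partitions_shift)
  fix q :: real assume q: "0 < q" "q < 1"
  have "1 / ((\<Prod>r\<in>{1, 3, 4, 7, 9, 13, 21, 22}. pprod q r) * (\<Prod>r\<in>{5, 12, 15, 16}. pprod q r)) = q ^ 0 * (1 / ((\<Prod>r\<in>{1, 3, 4, 7, 9, 13, 21, 22}. pprod q r) * (\<Prod>r\<in>{6, 8, 17, 19}. pprod q r))) + q ^ 5"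
    using product_identities(3)[OF q] pprod_nonzero[OF q]
    by (intro reciprocal_identity) (simp_all add: mult_ac)
  thus "1 / qprod q (pm_residue_class {1, 3, 4, 5, 7, 9, 12, 13, 15, 16, 21, 22} 50) = q ^ 0 * (1 / qprod q (pm_residue_class {1, 3, 4, 6, 7, 8, 9, 13, 17, 19, 21, 22} 50)) + q ^ 5"
    using qprod_pm_residue_class[OF q, of "{1, 3, 4, 5, 7, 9, 12, 13, 15, 16, 21, 22}"] qprod_pm_residue_class[OF q, of "{1, 3, 4, 6, 7, 8, 9, 13, 17, 19, 21, 22}"]
    by (simp add: mult_ac)
qed (rule zero_notin_pm_residue_class)+

lemma num_partitions_identity_iv:
  "real (num_partitions (pm_residue_class {2, 3, 5, 9, 11, 12, 13, 14, 15, 16, 21, 23} 50) n) =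
    (if 2 \<le> n then real (num_partitions (pm_residue_class {1, 3, 7, 9, 11, 12, 13, 16, 18, 21, 23, 24} 50) (n - 2)) else 0) + (if n = 0 then 1 else 0)"
proof (rule num_partitions_shift)
  fix q :: real assume q: "0 < q" "q < 1"
  have "1 / ((\<Prod>r\<in>{3, 9, 11, 12, 13, 16, 21, 23}. pprod q r) * (\<Prod>r\<in>{2, 5, 14, 15}. pprod q r)) = q ^ 2 * (1 / ((\<Prod>r\<in>{3, 9, 11, 12, 13, 16, 21, 23}. pprod q r) * (\<Prod>r\<in>{1, 7, 18, 24}. pprod q r))) + q ^ 0"
    using product_identities(4)[OF q] pprod_nonzero[OF q]
    by (intro reciprocal_identity) (simp_all add: mult_ac)
  thus "1 / qprod q (pm_residue_class {2, 3, 5, 9, 11, 12, 13, 14, 15, 16, 21, 23} 50) = q ^ 2 * (1 / qprod q (pm_residue_class {1, 3, 7, 9, 11, 12, 13, 16, 18, 21, 23, 24} 50)) + q ^ 0"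
    using qprod_pm_residue_class[OF q, of "{2, 3, 5, 9, 11, 12, 13, 14, 15, 16, 21, 23}"] qprod_pm_residue_class[OF q, of "{1, 3, 7, 9, 11, 12, 13, 16, 18, 21, 23, 24}"]
    by (simp add: mult_ac)
qed (rule zero_notin_pm_residue_class)+

lemma num_partitions_identity_v:
  "real (num_partitions (pm_residue_class {2, 5, 6, 8, 9, 11, 13, 14, 15, 17, 19, 23} 50) n) =
    (if 2 \<le> n then real (num_partitions (pm_residue_class {2, 3, 4, 9, 11, 13, 14, 17, 19, 21, 22, 23} 50) (n - 2)) else 0) + (if n = 0 then 1 else 0)"
proof (rule num_partitions_shift)
  fix q :: real assume q: "0 < q" "q < 1"
  have "1 / ((\<Prod>r\<in>{2, 9, 11, 13, 14, 17, 19, 23}. pprod q r) * (\<Prod>r\<in>{5, 6, 8, 15}. pprod q r)) = q ^ 2 * (1 / ((\<Prod>r\<in>{2, 9, 11, 13, 14, 17, 19, 23}. pprod q r) * (\<Prod>r\<in>{3, 4, 21, 22}. pprod q r))) + q ^ 0"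
    using product_identities(5)[OF q] pprod_nonzero[OF q]
    by (intro reciprocal_identity) (simp_all add: mult_ac)
  thus "1 / qprod q (pm_residue_class {2, 5, 6, 8, 9, 11, 13, 14, 15, 17, 19, 23} 50) = q ^ 2 * (1 / qprod q (pm_residue_class {2, 3, 4, 9, 11, 13, 14, 17, 19, 21, 22, 23} 50)) + q ^ 0"
    using qprod_pm_residue_class[OF q, of "{2, 5, 6, 8, 9, 11, 13, 14, 15, 17, 19, 23}"] qprod_pm_residue_class[OF q, of "{2, 3, 4, 9, 11, 13, 14, 17, 19, 21, 22, 23}"]
    by (simp add: mult_ac)
qed (rule zero_notin_pm_residue_class)+

theorem theorem8p2:
  shows "(let S = pm_residue_class {1, 6, 7, 8, 9, 11, 12, 13, 16, 17, 19, 23} 50;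
          T = pm_residue_class {1, 5, 6, 7, 8, 11, 15, 17, 18, 19, 23, 24} 50
      in \<forall>n\<ge>1. num_partitions S n = num_partitions T (n - 1))
    \<and> (let S = pm_residue_class {1, 3, 4, 5, 7, 15, 17, 18, 19, 21, 22, 24} 50;
          T = pm_residue_class {1, 2, 3, 7, 11, 14, 17, 18, 19, 21, 23, 24} 50
      in \<forall>n\<ge>1. num_partitions S n = num_partitions T (n - 1))
    \<and> (let S = pm_residue_class {1, 3, 4, 5, 7, 9, 12, 13, 15, 16, 21, 22} 50;
          T = pm_residue_class {1, 3, 4, 6, 7, 8, 9, 13, 17, 19, 21, 22} 50
      in \<forall>n. n \<noteq> 5 \<longrightarrow> num_partitions S n = num_partitions T n)
    \<and> (let S = pm_residue_class {2, 3, 5, 9, 11, 12, 13, 14, 15, 16, 21, 23} 50;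
          T = pm_residue_class {1, 3, 7, 9, 11, 12, 13, 16, 18, 21, 23, 24} 50
      in \<forall>n\<ge>2. num_partitions S n = num_partitions T (n - 2))
    \<and> (let S = pm_residue_class {2, 5, 6, 8, 9, 11, 13, 14, 15, 17, 19, 23} 50;
          T = pm_residue_class {2, 3, 4, 9, 11, 13, 14, 17, 19, 21, 22, 23} 50
      in \<forall>n\<ge>2. num_partitions S n = num_partitions T (n - 2))"
proof (unfold Let_def, intro conjI allI impI, goal_cases)
  case (1 n) thus ?case using num_partitions_identity_i[of n] by simp
next
  case (2 n) thus ?case using num_partitions_identity_ii[of n] by simp
next
  case (3 n) thus ?case using num_partitions_identity_iii[of n] by simp
next
  case (4 n) thus ?case using num_partitions_identity_iv[of n] by simp
next
  case (5 n) thus ?case using num_partitions_identity_v[of n] by simp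
qed

end
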